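(* Let $a\in\mathbb D$, $b=-a$, and $z=(0,\gamma)$ with $|a|^{3/2}<|\gamma|<|a|$. For $\varepsilon\in\mathbb C\setminus\{0\}$ let $L^\varepsilon_{aVbV}$ and $G^\varepsilon_{aVbV}$ be respectively Coman's Lempert function and the pluricomplex Green function on $\mathbb D^2$ with the four poles $(a,0),(b,0),(b,\varepsilon),(a,\varepsilon)$, all of weight $1$. Then $\liminf_{\varepsilon\to0}L^\varepsilon_{aVbV}(z)>G_{aVbV}(z)$, and consequently, for $|\varepsilon|$ small enough, $G^\varepsilon_{aVbV}(z)<L^\varepsilon_{aVbV}(z)$. In particular, Coman's conjecture (equality of the Lempert and Green functions with equal weights on convex domains) fails in the bidisc.
   Context: $\mathbb D$ is the open unit disc. Green function with poles $p_1,\dots,p_k$ of weight 1 on $\mathbb D^2$: $\sup\{u(z):u$ negative plurisubharmonic on $\mathbb D^2$, $u(x)\le\log\|x-p_j\|+C_j$ near $p_j\}$. Coman's Lempert function: $\inf\{\sum_j\log|\zeta_j|:\varphi:\mathbb D\to\mathbb D^2$ holomorphic, $\varphi(0)=z$, $\zeta_j\in\mathbb D$, $\varphi(\zeta_j)=p_j\}$. With $\Psi_V(w)=\max(\log|w_1|,2\log|w_2|)$, $G_{aVbV}(z)=\sup\{u(z):u$ negative plurisubharmonic on $\mathbb D^2$, $u(x)\le\Psi_V(x-(a,0))+C_1$ near $(a,0)$ and $u(x)\le\Psi_V(x-(b,0))+C_2$ near $(b,0)\}$. *)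

theory Defs
  imports "HOL-Analysis.Analysis"
begin

text \<open>Points of C^2 are pairs of complex numbers; the norm on the product type is the
  Euclidean norm sqrt(|w1|^2 + |w2|^2).\<close>

type_synonym c2 = "complex \<times> complex"

definition eln :: "real \<Rightarrow> ereal" where
  "eln t = (if t = 0 then -\<infinity> else ereal (ln t))"

definition unit_disc :: "complex set" where
  "unit_disc = ball 0 1"

definition bidisc :: "c2 set" where
  "bidisc = unit_disc \<times> unit_disc"

definition cline :: "c2 \<Rightarrow> c2 \<Rightarrow> complex \<Rightarrow> c2" where
  "cline a b \<zeta> = (fst a + \<zeta> * fst b, snd a + \<zeta> * snd b)"

text \<open>Plurisubharmonic functions on an open set Omega of C^2 (values in [-infinity, infinity)):
  upper semicontinuous, and satisfying the sub-mean-value inequality on every closed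
  analytic disc  zeta |-> a + zeta b, |zeta| <= 1, contained in Omega:
     u(a) <= (1/(2 pi)) \<integral>_0^{2 pi} u(a + e^{it} b) dt.
  Since u is bounded above by some real M on the circle, the mean is written as
  M - (1/(2 pi)) \<integral> (M - u), with the nonnegative integral in [0, infinity].\<close>
definition psh :: "c2 set \<Rightarrow> (c2 \<Rightarrow> ereal) \<Rightarrow> bool" where
  "psh \<Omega> u \<longleftrightarrow>
     (\<forall>x\<in>\<Omega>. u x \<noteq> \<infinity>) \<and>
     (\<forall>x\<in>\<Omega>. \<forall>c. u x < c \<longrightarrow> eventually (\<lambda>y. u y < c) (nhds x)) \<and>
     (\<forall>a b. (\<forall>\<zeta>. norm \<zeta> \<le> 1 \<longrightarrow> cline a b \<zeta> \<in> \<Omega>) \<longrightarrow>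
        (\<forall>M::real. (\<forall>t. u (cline a b (cis t)) \<le> ereal M) \<longrightarrow>
           u a \<le> ereal M - ereal (1 / (2 * pi)) *
              enn2ereal (\<integral>\<^sup>+ t \<in> {0..2*pi}. e2ennreal (ereal M - u (cline a b (cis t))) \<partial>lborel)))"

definition green :: "c2 list \<Rightarrow> c2 \<Rightarrow> ereal" where
  "green p z = Sup {u z | u. psh bidisc u \<and> (\<forall>x\<in>bidisc. u x < 0) \<and>
      (\<forall>j<length p. \<exists>C::real. eventually (\<lambda>x. u x \<le> eln (norm (x - p!j)) + ereal C) (nhds (p!j)))}"

definition coman_lempert :: "c2 list \<Rightarrow> c2 \<Rightarrow> ereal" where
  "coman_lempert p z = Inf {(\<Sum>j<length p. eln (norm (\<zeta> j))) | \<phi> \<zeta>.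
      (fst \<circ> \<phi>) holomorphic_on unit_disc \<and> (snd \<circ> \<phi>) holomorphic_on unit_disc \<and>
      \<phi> ` unit_disc \<subseteq> bidisc \<and> \<phi> 0 = z \<and>
      (\<forall>j<length p. \<zeta> j \<in> unit_disc \<and> \<phi> (\<zeta> j) = p!j)}"

definition PsiV :: "c2 \<Rightarrow> ereal" where
  "PsiV w = max (eln (norm (fst w))) (2 * eln (norm (snd w)))"

definition G_aVbV :: "complex \<Rightarrow> complex \<Rightarrow> c2 \<Rightarrow> ereal" where
  "G_aVbV a b z = Sup {u z | u. psh bidisc u \<and> (\<forall>x\<in>bidisc. u x < 0) \<and>
      (\<exists>C1::real. eventually (\<lambda>x. u x \<le> PsiV (x - (a,0)) + ereal C1) (nhds (a,0))) \<and>
      (\<exists>C2::real. eventually (\<lambda>x. u x \<le> PsiV (x - (b,0)) + ereal C2) (nhds (b,0)))}"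

end

theory Submission
  imports Defs "HOL-Complex_Analysis.Riemann_Mapping"
begin

text \<open>
  Both Green functions are at most \<open>2 ln |a|\<close> at \<open>z\<close>: for small \<open>\<epsilon>\<close>, including \<open>\<epsilon> = 0\<close>, the point \<open>z\<close> lies on
  the analytic curve \<open>y (y - \<epsilon>) = c b(x)\<close>, where \<open>b\<close> is the Blaschke product with zeros \<open>a\<close>, \<open>-a\<close> and
  \<open>|c| + |\<epsilon>| < 1\<close>. The curve leaves the bidisc only through \<open>|x| = 1\<close>, and on it every competitor
  satisfies \<open>u \<le> ln |b(x)| + O(1)\<close> at the poles, hence \<open>u \<le> ln |b(x)|\<close> by the maximum principle.

  For a disc \<open>(f, g)\<close> through \<open>z\<close> and the four poles, the Schwarz lemma gives \<open>|\<zeta>1 \<zeta>4| \<ge> |a|\<close> and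
  \<open>|\<zeta>2 \<zeta>3| \<ge> |a|\<close>. If both were nearly equalities, \<open>f\<close> would be close to a Blaschke product of degree two
  on the relevant compact sets. Such a product has only one critical point, so one of the pairs, say
  \<open>\<zeta>2, \<zeta>3\<close>, stays separated. Then \<open>g\<close> (or \<open>g - \<epsilon>\<close>) has, up to \<open>O(\<epsilon>)\<close>, three zeros: those two and the
  smaller of \<open>\<zeta>1, \<zeta>4\<close>. This forces \<open>|\<gamma>| \<le> |a| powr (3/2) + o(1)\<close>.
\<close>

section \<open>Plurisubharmonic functions along an analytic curve\<close>

text \<open>\<open>psh\<close> tests \<open>u\<close> on affine discs only, so nothing is known in
  advance about \<open>u\<close> restricted to a curve. The maximum principle is therefore run in
  the ambient space, for \<open>u - s ln |G| + e |x|^2 - N |F|^2\<close> with \<open>N\<close>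
  large: the last term keeps the maximum away from those boundary points that lie off the curve
  \<open>F = 0\<close>. At \<open>x = 0\<close> the Blaschke product has modulus
  \<open>|a|^2\<close>, the source of \<open>2 ln |a|\<close>. For \<open>\<epsilon> = 0\<close> the
  coefficient of the curve has modulus \<open>|\<gamma>|^2 / |a|^2\<close>, so
  \<open>|\<gamma>| < |a|\<close> is what keeps the curve off \<open>|y| = 1\<close>. The additive
  constants at the poles blow up as \<open>\<epsilon>\<close> tends to 0, but they disappear from
  the final bound, which is therefore uniform. The exponent \<open>3/2\<close> is one half plus one:
  the smaller point of one pair has modulus at most about the square root of \<open>|a|\<close>, and
  the product of the other pair is about \<open>|a|\<close>. The gain \<open>1 + \<kappa>\<close> in
  the product of all four points depends on \<open>a\<close> and \<open>\<gamma>\<close> only; this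
  makes the inequality for the liminf strict.\<close>

lemma has_integral_circle_mean:
  fixes H :: "complex \<Rightarrow> complex"
  assumes "H holomorphic_on cball 0 1"
  shows "((\<lambda>t. H (cis t)) has_integral (2 * pi * H 0)) {0..2 * pi}"
proof -
  have "((\<lambda>u. H u / (u - 0)) has_contour_integral (2 * of_real pi * \<i> * H 0)) (part_circlepath 0 1 0 (2 * pi))"
    using Cauchy_integral_circlepath_simple[OF assms, of 0] by (simp add: circlepath_def)
  then have "((\<lambda>t. H (0 + of_real 1 * cis t) / (0 + of_real 1 * cis t - 0) * of_real 1 * \<i> * cis t)
      has_integral (2 * of_real pi * \<i> * H 0)) {0..2 * pi}"
    by (subst (asm) has_contour_integral_part_circlepath_iff) simp_all
  then have "((\<lambda>t. - \<i> * (H (cis t) * \<i>)) has_integral (- \<i> * (2 * of_real pi * \<i> * H 0))) {0..2 * pi}"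
    by (intro has_integral_mult_right) simp
  moreover have "- \<i> * (w * \<i>) = w" "- \<i> * (2 * of_real pi * \<i> * w) = 2 * pi * w" for w :: complex
    by (simp_all add: complex_eq_iff)
  ultimately show ?thesis by (simp only:)
qed

text \<open>The mean of \<open>Re H\<close> over the circle is its value at the centre, so the
  sub-mean-value inequality passes from \<open>u\<close> to its majorant. A bound of
  \<open>|H|\<close> on the closed disc serves as the constant \<open>M\<close> in
  \<open>psh\<close> and makes both integrands nonnegative.\<close>

lemma psh_le_Re_holomorphic:
  fixes H :: "complex \<Rightarrow> complex"
  assumes u: "psh \<Omega> u"
    and disc: "\<And>\<zeta>. norm \<zeta> \<le> 1 \<Longrightarrow> cline p b \<zeta> \<in> \<Omega>"
    and H: "H holomorphic_on cball 0 1"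
    and le: "\<And>t. u (cline p b (cis t)) \<le> ereal (Re (H (cis t)))"
  shows "u p \<le> ereal (Re (H 0))"
proof -
  have "bounded (H ` cball 0 1)"
    by (intro compact_imp_bounded compact_continuous_image holomorphic_on_imp_continuous_on H) auto
  then obtain M where M: "\<And>\<zeta>. norm \<zeta> \<le> 1 \<Longrightarrow> norm (H \<zeta>) \<le> M"
    unfolding bounded_iff by (metis imageI mem_cball_0)
  have ReM: "Re (H (cis t)) \<le> M" for t
    using M[of "cis t"] complex_Re_le_cmod[of "H (cis t)"] by simp
  have "((\<lambda>t. Re (H (cis t))) has_integral (Re (2 * pi * H 0))) {0..2 * pi}"
    using has_integral_circle_mean[OF H] has_integral_Re by blast
  then have I: "((\<lambda>t. M - Re (H (cis t))) has_integral (2 * pi * M - 2 * pi * Re (H 0))) {0..2 * pi}"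
    using has_integral_diff[OF has_integral_const_real[of M 0 "2 * pi"]] by simp
  have nn: "2 * pi * M - 2 * pi * Re (H 0) \<ge> 0"
    using has_integral_nonneg[OF I] ReM by simp
  have "ennreal (2 * pi * M - 2 * pi * Re (H 0)) =
      (\<integral>\<^sup>+ t. ennreal (M - Re (H (cis t))) * indicator {0..2*pi} t \<partial>lborel)"
    using nn_integral_has_integral_lebesgue'[OF _ I] ReM by simp
  also have "\<dots> \<le> (\<integral>\<^sup>+ t \<in> {0..2*pi}. e2ennreal (ereal M - u (cline p b (cis t))) \<partial>lborel)"
  proof (intro nn_integral_mono mult_right_mono)
    fix t
    have "ereal M - ereal (Re (H (cis t))) \<le> ereal M - u (cline p b (cis t))"
      by (intro ereal_minus_mono le) simp
    then show "ennreal (M - Re (H (cis t))) \<le> e2ennreal (ereal M - u (cline p b (cis t)))"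
      using e2ennreal_mono by fastforce
  qed simp
  finally have ge: "ereal (2 * pi * M - 2 * pi * Re (H 0)) \<le>
      enn2ereal (\<integral>\<^sup>+ t \<in> {0..2*pi}. e2ennreal (ereal M - u (cline p b (cis t))) \<partial>lborel)"
    using nn unfolding less_eq_ennreal.rep_eq by simp
  have "u (cline p b (cis t)) \<le> ereal M" for t
    using le[of t] ReM[of t] by (meson ereal_less_eq(3) order_trans)
  then have "u p \<le> ereal M - ereal (1 / (2 * pi)) *
      enn2ereal (\<integral>\<^sup>+ t \<in> {0..2*pi}. e2ennreal (ereal M - u (cline p b (cis t))) \<partial>lborel)"
    using u[unfolded psh_def, THEN conjunct2, THEN conjunct2, rule_format, of p b M] disc by simp
  also have "\<dots> \<le> ereal M - ereal (1 / (2 * pi)) * ereal (2 * pi * M - 2 * pi * Re (H 0))"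
    by (intro ereal_minus_mono ereal_mult_left_mono ge) simp_all
  also have "\<dots> = ereal (Re (H 0))"
    by (simp add: field_simps)
  finally show ?thesis .
qed

section \<open>Upper semicontinuous functions on compact sets\<close>

text \<open>Neighbourhoods are cut with \<open>K\<close> because the functions added to
  \<open>u\<close> later, such as \<open>ln |G|\<close>, are continuous only on
  \<open>K\<close>.\<close>

definition usc_on :: "'a::topological_space set \<Rightarrow> ('a \<Rightarrow> ereal) \<Rightarrow> bool" where
  "usc_on K v \<longleftrightarrow> (\<forall>x\<in>K. v x \<noteq> \<infinity>) \<and>
     (\<forall>x\<in>K. \<forall>c. v x < c \<longrightarrow> (\<exists>T. open T \<and> x \<in> T \<and> (\<forall>y\<in>T \<inter> K. v y < c)))"

lemma usc_on_not_PInf: "usc_on K v \<Longrightarrow> x \<in> K \<Longrightarrow> v x \<noteq> \<infinity>"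
  unfolding usc_on_def by (drule conjunct1) blast

lemma usc_onD:
  assumes "usc_on K v" "x \<in> K" "v x < c"
  obtains T where "open T" "x \<in> T" "\<And>y. y \<in> T \<Longrightarrow> y \<in> K \<Longrightarrow> v y < c"
  using assms unfolding usc_on_def by (metis IntI)

lemma usc_on_subset:
  assumes "usc_on K v" "L \<subseteq> K"
  shows "usc_on L v"
  unfolding usc_on_def
proof (intro conjI ballI allI impI)
  show "v x \<noteq> \<infinity>" if "x \<in> L" for x
    using usc_on_not_PInf[OF assms(1) subsetD[OF assms(2) that]] .
  fix x c assume "x \<in> L" "v x < c"
  then obtain T where "open T" "x \<in> T" "\<And>y. y \<in> T \<Longrightarrow> y \<in> K \<Longrightarrow> v y < c"
    using usc_onD[OF assms(1) subsetD[OF assms(2)]] by metis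
  then show "\<exists>T. open T \<and> x \<in> T \<and> (\<forall>y\<in>T \<inter> L. v y < c)"
    using assms(2) by (intro exI[of _ T]) auto
qed

lemma psh_imp_usc_on:
  assumes "psh \<Omega> u"
  shows "usc_on \<Omega> u"
  unfolding usc_on_def
proof (intro conjI ballI allI impI)
  show "u x \<noteq> \<infinity>" if "x \<in> \<Omega>" for x
    using assms that by (simp add: psh_def)
  fix x c assume "x \<in> \<Omega>" "u x < c"
  then have "eventually (\<lambda>y. u y < c) (nhds x)"
    using assms[unfolded psh_def] by simp
  then show "\<exists>T. open T \<and> x \<in> T \<and> (\<forall>y\<in>T \<inter> \<Omega>. u y < c)"
    unfolding eventually_nhds by auto
qed

lemma usc_on_add_continuous:
  fixes g :: "'a::topological_space \<Rightarrow> real"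
  assumes v: "usc_on K v" and g: "continuous_on K g"
  shows "usc_on K (\<lambda>x. v x + ereal (g x))"
  unfolding usc_on_def
proof (intro conjI ballI allI impI)
  show "v x + ereal (g x) \<noteq> \<infinity>" if "x \<in> K" for x
    using usc_on_not_PInf[OF v that] by auto
next
  fix x c assume x: "x \<in> K" and lt: "v x + ereal (g x) < c"
  show "\<exists>T. open T \<and> x \<in> T \<and> (\<forall>y\<in>T \<inter> K. v y + ereal (g y) < c)"
  proof (cases c)
    case (real c')
    have vx: "v x < ereal (c' - g x)"
      using lt real by (cases "v x") (simp_all add: less_diff_eq)
    obtain d where d: "v x < ereal d" "ereal d < ereal (c' - g x)"
      using ereal_dense2[OF vx] by (elim exE conjE)
    obtain T1 where T1: "open T1" "x \<in> T1" "\<And>y. y \<in> T1 \<Longrightarrow> y \<in> K \<Longrightarrow> v y < ereal d"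
      by (rule usc_onD[OF v x d(1)]) (rule that)
    have "\<exists>T2. open T2 \<and> T2 \<inter> K = g -` {..<c' - d} \<inter> K"
      using iffD1[OF continuous_on_open_invariant g] open_lessThan by blast
    then obtain T2 where T2: "open T2" "T2 \<inter> K = g -` {..<c' - d} \<inter> K" by blast
    show ?thesis
    proof (intro exI conjI ballI)
      show "open (T1 \<inter> T2)" using T1 T2 by blast
      show "x \<in> T1 \<inter> T2" using T1 T2 x d by auto
      fix y assume y: "y \<in> T1 \<inter> T2 \<inter> K"
      then have "v y < ereal d" "g y < c' - d" using T1(3) T2(2) by auto
      then show "v y + ereal (g y) < c"
        unfolding real by (cases "v y") auto
    qed
  next
    case PInf
    then show ?thesis using usc_on_not_PInf[OF v] by (intro exI[of _ UNIV]) auto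
  qed (use lt in auto)
qed

lemma compact_usc_superlevel:
  assumes "compact K" "usc_on K v"
  shows "compact {x\<in>K. c \<le> v x}"
proof -
  define T where "T = \<Union>{T. open T \<and> (\<forall>y\<in>T \<inter> K. v y < c)}"
  have "open T" unfolding T_def by auto
  have "x \<in> T" if x: "x \<in> K" "v x < c" for x
  proof -
    obtain S where "open S" "x \<in> S" "\<And>y. y \<in> S \<Longrightarrow> y \<in> K \<Longrightarrow> v y < c"
      by (rule usc_onD[OF assms(2) x]) (rule that)
    then show ?thesis unfolding T_def by auto
  qed
  moreover have "\<not> c \<le> v x" if "x \<in> T" "x \<in> K" for x
    using that unfolding T_def by (auto simp: not_le)
  ultimately have "{x\<in>K. c \<le> v x} = K - T"
    by (auto simp: not_le[symmetric])
  then show ?thesis using assms(1) \<open>open T\<close> by (simp add: compact_diff)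
qed

text \<open>Without a maximum, \<open>K\<close> is covered by open sets on which \<open>v\<close>
  stays below some value \<open>v y\<close>. In a finite subcover take the largest such value: the
  point where it is attained lies in a member of the subcover and so has a value below another one
  of the list.\<close>

lemma usc_on_attains_sup:
  assumes K: "compact K" "K \<noteq> {}" and v: "usc_on K v"
  shows "\<exists>x\<in>K. \<forall>y\<in>K. v y \<le> v x"
proof (rule ccontr)
  assume "\<not> ?thesis"
  then have ex: "\<forall>x\<in>K. \<exists>y\<in>K. v x < v y" by (auto simp: not_le)
  define \<T> where "\<T> y = {T. open T \<and> (\<forall>x\<in>T \<inter> K. v x < v y)}" for y
  have "K \<subseteq> \<Union>(\<Union>y\<in>K. \<T> y)"
  proof
    fix x assume x: "x \<in> K"
    then obtain y where "y \<in> K" "v x < v y" using ex by blast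
    moreover obtain T where "open T" "x \<in> T" "\<And>z. z \<in> T \<Longrightarrow> z \<in> K \<Longrightarrow> v z < v y"
      by (rule usc_onD[OF v x \<open>v x < v y\<close>]) (rule that)
    ultimately have "T \<in> \<T> y" unfolding \<T>_def by auto
    then show "x \<in> \<Union>(\<Union>y\<in>K. \<T> y)" using \<open>x \<in> T\<close> \<open>y \<in> K\<close> by blast
  qed
  moreover have "open T" if "T\<in>(\<Union>y\<in>K. \<T> y)" for T
    using that by (auto simp: \<T>_def)
  ultimately obtain \<D> where \<D>: "\<D> \<subseteq> (\<Union>y\<in>K. \<T> y)" "finite \<D>" "K \<subseteq> \<Union>\<D>"
    by (rule compactE[OF K(1)])
  have "\<forall>T\<in>\<D>. \<exists>y\<in>K. T \<in> \<T> y" using \<D> by blast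
  then obtain f where f: "\<And>T. T \<in> \<D> \<Longrightarrow> f T \<in> K \<and> T \<in> \<T> (f T)" by metis
  have ne: "\<D> \<noteq> {}" using K(2) \<D>(3) by blast
  obtain T0 where T0: "T0 \<in> \<D>" "\<And>T. T \<in> \<D> \<Longrightarrow> v (f T) \<le> v (f T0)"
  proof -
    have "Max ((\<lambda>T. v (f T)) ` \<D>) \<in> (\<lambda>T. v (f T)) ` \<D>" using ne \<D>(2) by simp
    then obtain T0 where "T0 \<in> \<D>" "Max ((\<lambda>T. v (f T)) ` \<D>) = v (f T0)" by blast
    then show ?thesis using that[of T0] Max_ge[OF finite_imageI[OF \<D>(2)], of _ "\<lambda>T. v (f T)"] by simp
  qed
  then obtain T where "T \<in> \<D>" "f T0 \<in> T" using f \<D>(3) by blast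
  then have "v (f T0) < v (f T)" using f T0(1) unfolding \<T>_def by blast
  with T0(2) \<open>T \<in> \<D>\<close> show False by (simp add: leD)
qed

section \<open>A maximum principle on the zero set of a function\<close>

text \<open>Required at every point and not only on \<open>F = 0\<close>, since the penalised
  function may have its maximum off the curve. At a critical point of \<open>F\<close> any direction
  may serve.\<close>

definition tangent_lines :: "(c2 \<Rightarrow> complex) \<Rightarrow> bool" where
  "tangent_lines F \<longleftrightarrow> (\<forall>p. \<exists>b P. b \<noteq> 0 \<and> P holomorphic_on UNIV \<and>
     (\<forall>\<zeta>. F (cline p b \<zeta>) = F p + \<zeta>\<^sup>2 * P \<zeta>))"

lemma cmod_add_square: "(cmod (z + w))\<^sup>2 = (cmod z)\<^sup>2 + 2 * Re (cnj z * w) + (cmod w)\<^sup>2"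
  by (simp only: cmod_power2) (simp add: power2_eq_square algebra_simps)

text \<open>Along the tangent line \<open>F = F p + \<zeta>\<^sup>2 P\<close>, so up to \<open>O(|\<zeta>|\<^sup>4)\<close> the penalty \<open>|F|\<^sup>2\<close> is pluriharmonic;
  the term \<open>e |x|\<^sup>2\<close> then contradicts the sub-mean-value inequality on small circles. This
  replaces the usual regularisation of \<open>u\<close> by convolution.\<close>

lemma no_interior_max:
  fixes F :: "c2 \<Rightarrow> complex" and G :: "complex \<Rightarrow> complex" and s e N r :: real
  assumes u: "psh \<Omega> u" and U: "open U" "U \<subseteq> \<Omega>" "p \<in> U"
    and G: "G holomorphic_on S" "open S" "fst p \<in> S" "G (fst p) \<noteq> 0"
    and F: "tangent_lines F" and e: "e > 0" and N: "N \<ge> 0"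
    and g: "\<And>x. g x = e * ((norm (fst x))\<^sup>2 + (norm (snd x))\<^sup>2) - N * (norm (F x))\<^sup>2 - s * ln (norm (G (fst x)))"
    and up: "u p = ereal r"
    and max: "\<And>x. x \<in> U \<Longrightarrow> u x \<le> ereal (r + g p - g x)"
  shows False
proof -
  obtain b P where b: "b \<noteq> 0" and P: "P holomorphic_on UNIV"
    and FP: "\<And>\<zeta>. F (cline p b \<zeta>) = F p + \<zeta>\<^sup>2 * P \<zeta>"
    using F unfolding tangent_lines_def by metis
  obtain b1 b2 where bb: "b = (b1, b2)" by (cases b)
  obtain x0 y0 where pp: "p = (x0, y0)" by (cases p)
  define B where "B = (norm b1)\<^sup>2 + (norm b2)\<^sup>2"
  have B: "B > 0"
    using b unfolding B_def bb by (metis bb less_add_same_cancel1 add_pos_nonneg norm_eq_zero not_sum_power2_lt_zero linorder_neqE_linordered_idom power2_eq_square sum_power2_gt_zero_iff zero_prod_def)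
  \<comment> \<open>The quotient is 1 at the centre, so near it the principal branch
    \<open>Ln\<close> is holomorphic.\<close>
  define Q where "Q \<zeta> = G (x0 + \<zeta> * b1) / G x0" for \<zeta>
  define S' where "S' = (\<lambda>\<zeta>. x0 + \<zeta> * b1) -` S"
  have x0: "x0 \<in> S" "G x0 \<noteq> 0" using G pp by auto
  have openS': "open S'" unfolding S'_def
    by (intro continuous_open_vimage G continuous_intros)
  have Qhol: "Q holomorphic_on S'"
    unfolding Q_def S'_def
    by (intro holomorphic_intros holomorphic_on_compose_gen[OF _ G(1), unfolded o_def]) auto
  have "0 \<in> S'" by (simp add: S'_def x0)
  have "isCont Q 0"
    using Qhol openS' \<open>0 \<in> S'\<close> holomorphic_on_imp_continuous_on continuous_on_eq_continuous_at by blast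
  then have "(Q \<longlongrightarrow> 1) (nhds 0)"
    unfolding isCont_def tendsto_at_iff_tendsto_nhds by (simp add: Q_def x0)
  then have "((\<lambda>\<zeta>. Re (Q \<zeta>)) \<longlongrightarrow> 1) (nhds 0)"
    using tendsto_Re by fastforce
  then have ev1: "\<forall>\<^sub>F \<zeta> in nhds 0. Re (Q \<zeta>) > 0"
    by (rule order_tendstoD(1)) simp
  have "open (cline p b -` U)"
    unfolding cline_def by (intro continuous_open_vimage U continuous_intros)
  then have ev2: "\<forall>\<^sub>F \<zeta> in nhds 0. \<zeta> \<in> cline p b -` U"
    by (rule eventually_nhds_in_open) (use U in \<open>simp add: cline_def\<close>)
  have ev3: "\<forall>\<^sub>F \<zeta> in nhds 0. \<zeta> \<in> S'"
    by (rule eventually_nhds_in_open[OF openS' \<open>0 \<in> S'\<close>])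
  from eventually_conj[OF ev1 eventually_conj[OF ev2 ev3]]
  obtain \<rho> where \<rho>: "\<rho> > 0" and near: "\<And>\<zeta>. norm \<zeta> < \<rho> \<Longrightarrow> Re (Q \<zeta>) > 0 \<and> cline p b \<zeta> \<in> U \<and> \<zeta> \<in> S'"
    unfolding eventually_nhds_metric by auto
  have "bounded (P ` cball 0 1)"
    by (intro compact_imp_bounded compact_continuous_image continuous_on_subset[OF holomorphic_on_imp_continuous_on[OF P]]) auto
  then obtain C where C: "\<And>\<zeta>. norm \<zeta> \<le> 1 \<Longrightarrow> norm (P \<zeta>) \<le> C"
    unfolding bounded_iff by (metis imageI mem_cball_0)
  \<comment> \<open>The radius \<open>t\<close> is taken so small that the quartic loss
    \<open>N t^4 C^2\<close> from the penalty stays below the quadratic gain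
    \<open>e t^2 B\<close>.\<close>
  have "((\<lambda>t. N * t\<^sup>2 * C\<^sup>2) \<longlongrightarrow> N * 0\<^sup>2 * C\<^sup>2) (at_right (0::real))"
    by (intro tendsto_intros)
  then have evt: "\<forall>\<^sub>F t in at_right 0. N * t\<^sup>2 * C\<^sup>2 < e * B"
    using B e by (intro order_tendstoD(2)[where y = 0]) auto
  have "\<forall>\<^sub>F t::real in at_right 0. t \<in> {0<..<min 1 \<rho>}"
    using \<rho> by (intro eventually_at_right_real) simp
  from eventually_happens'[OF _ eventually_conj[OF evt this]]
  obtain t where t: "0 < t" "t < 1" "t < \<rho>" "N * t\<^sup>2 * C\<^sup>2 < e * B"
    by auto
  \<comment> \<open>Termwise majorant of \<open>r + g p - g x\<close> on the circle: the logarithm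
    is exactly the real part of \<open>Ln Q\<close>, \<open>e |x|^2\<close> gives a linear term and
    the constant \<open>e t^2 B\<close>, and \<open>|F|^2\<close> gives its cross term and at most
    \<open>t^4 C^2\<close>. At the centre only the first, real constant survives.\<close>
  define H where "H \<zeta> = of_real (r - e * t\<^sup>2 * B + N * t^4 * C\<^sup>2) + of_real s * Ln (Q (of_real t * \<zeta>))
      + of_real (2 * N) * cnj (F p) * (of_real t * \<zeta>)\<^sup>2 * P (of_real t * \<zeta>)
      - of_real (2 * e) * (of_real t * \<zeta>) * (cnj x0 * b1 + cnj y0 * b2)" for \<zeta>
  have small: "norm (of_real t * \<zeta>) < \<rho>" "norm (of_real t * \<zeta>) \<le> 1" if "norm \<zeta> \<le> 1" for \<zeta> :: complex
  proof -
    have "t * norm \<zeta> \<le> t" using that t by (intro mult_left_le) auto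
    moreover have "norm (of_real t * \<zeta>) = t * norm \<zeta>" using t by (simp add: norm_mult)
    ultimately show "norm (of_real t * \<zeta>) < \<rho>" "norm (of_real t * \<zeta>) \<le> 1"
      using t by linarith+
  qed
  have Hhol: "H holomorphic_on cball 0 1"
    unfolding H_def
  proof (intro holomorphic_intros)
    show "(\<lambda>z. Q (complex_of_real t * z)) holomorphic_on cball 0 1"
      by (intro holomorphic_on_compose_gen[OF _ Qhol, unfolded o_def] holomorphic_intros) (use small near in force)
    show "(\<lambda>z. P (complex_of_real t * z)) holomorphic_on cball 0 1"
      by (intro holomorphic_on_compose_gen[OF _ P, unfolded o_def] holomorphic_intros) auto
    show "Q (complex_of_real t * \<zeta>) \<notin> \<real>\<^sub>\<le>\<^sub>0" if "\<zeta> \<in> cball 0 1" for \<zeta>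
      using near[OF small(1)[of \<zeta>]] that complex_nonpos_Reals_iff by force
  qed
  have cl: "cline p (of_real t * b1, of_real t * b2) \<zeta> = cline p b (of_real t * \<zeta>)" for \<zeta>
    by (simp add: cline_def bb)
  have "u p \<le> ereal (Re (H 0))"
  proof (rule psh_le_Re_holomorphic[OF u _ Hhol])
    show "cline p (of_real t * b1, of_real t * b2) \<zeta> \<in> \<Omega>" if "norm \<zeta> \<le> 1" for \<zeta>
      unfolding cl using near[OF small(1)[OF that]] U by blast
    fix \<theta>
    define \<xi> where "\<xi> = of_real t * cis \<theta>"
    define x where "x = cline p b \<xi>"
    have \<xi>: "norm \<xi> = t" using t by (simp add: \<xi>_def norm_mult)
    have nr: "Re (Q \<xi>) > 0" "x \<in> U" "\<xi> \<in> S'" using near[of \<xi>] t \<xi> by (auto simp: x_def)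
    have Gx: "G (fst x) \<noteq> 0" using nr(1) by (auto simp: Q_def x_def cline_def pp bb)
    have "(norm (F x))\<^sup>2 = (norm (F p))\<^sup>2 + 2 * Re (cnj (F p) * (\<xi>\<^sup>2 * P \<xi>)) + (norm (\<xi>\<^sup>2 * P \<xi>))\<^sup>2"
      unfolding x_def FP by (rule cmod_add_square)
    also have "(norm (\<xi>\<^sup>2 * P \<xi>))\<^sup>2 = t^4 * (norm (P \<xi>))\<^sup>2"
      by (simp add: norm_mult norm_power \<xi> power_mult_distrib flip: power_mult)
    also have "\<dots> \<le> t^4 * C\<^sup>2"
      using C[of \<xi>] \<xi> t by (intro mult_left_mono power_mono) auto
    finally have 1: "(norm (F x))\<^sup>2 - (norm (F p))\<^sup>2 \<le> 2 * Re (cnj (F p) * (\<xi>\<^sup>2 * P \<xi>)) + t^4 * C\<^sup>2" by simp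
    have 2: "(norm (fst x))\<^sup>2 + (norm (snd x))\<^sup>2 = (norm x0)\<^sup>2 + (norm y0)\<^sup>2
        + 2 * Re (\<xi> * (cnj x0 * b1 + cnj y0 * b2)) + t\<^sup>2 * B"
      by (simp add: x_def cline_def pp bb cmod_add_square norm_mult \<xi> B_def power_mult_distrib algebra_simps)
    have "Re (Ln (Q \<xi>)) = ln (norm (Q \<xi>))"
      using nr(1) by (intro Re_Ln) auto
    also have "Q \<xi> = G (fst x) / G (fst p)" by (simp add: Q_def x_def cline_def pp bb)
    also have "ln (norm (G (fst x) / G (fst p))) = ln (norm (G (fst x))) - ln (norm (G (fst p)))"
      using Gx G(4) by (simp add: norm_divide ln_div)
    finally have 3: "Re (Ln (Q \<xi>)) = ln (norm (G (fst x))) - ln (norm (G (fst p)))"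
      by (simp add: Q_def x_def cline_def pp bb)
    have ReH: "Re (H (cis \<theta>)) = r - e * t\<^sup>2 * B + N * t^4 * C\<^sup>2 + s * Re (Ln (Q \<xi>))
      + 2 * N * Re (cnj (F p) * (\<xi>\<^sup>2 * P \<xi>)) - 2 * e * Re (\<xi> * (cnj x0 * b1 + cnj y0 * b2))"
    proof -
      have "H (cis \<theta>) = of_real (r - e * t\<^sup>2 * B + N * t^4 * C\<^sup>2) + of_real s * Ln (Q \<xi>)
        + of_real (2 * N) * (cnj (F p) * (\<xi>\<^sup>2 * P \<xi>)) - of_real (2 * e) * (\<xi> * (cnj x0 * b1 + cnj y0 * b2))"
        unfolding H_def \<xi>_def by (simp only: mult.assoc)
      moreover have "Re (of_real k * w) = k * Re w" for k w by simp
      ultimately show ?thesis by (simp only: Re_complex_of_real plus_complex.sel minus_complex.sel)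
    qed
    have "r + g p - g x \<le> Re (H (cis \<theta>))"
    proof -
      have "N * ((norm (F x))\<^sup>2 - (norm (F p))\<^sup>2) \<le> N * (2 * Re (cnj (F p) * (\<xi>\<^sup>2 * P \<xi>)) + t^4 * C\<^sup>2)"
        by (rule mult_left_mono[OF 1 N])
      then show ?thesis
        unfolding g 2 ReH 3 by (simp add: pp algebra_simps)
    qed
    then have "u x \<le> ereal (Re (H (cis \<theta>)))"
      using max[OF nr(2)] by (meson ereal_less_eq(3) order_trans)
    then show "u (cline p (of_real t * b1, of_real t * b2) (cis \<theta>)) \<le> ereal (Re (H (cis \<theta>)))"
      unfolding cl by (simp add: x_def \<xi>_def)
  qed
  then have "r \<le> r - e * t\<^sup>2 * B + N * t^4 * C\<^sup>2"
    using up x0 by (simp add: H_def Q_def)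
  then have "t\<^sup>2 * (e * B) \<le> t\<^sup>2 * (N * t\<^sup>2 * C\<^sup>2)"
    by (simp add: algebra_simps power2_eq_square power4_eq_xxxx)
  then show False using t by simp
qed

text \<open>The set \<open>K - U\<close> plays the role of the boundary. Where the bound fails there
  by at least \<open>e\<close>, \<open>F\<close> has no zero, so by compactness \<open>|F|\<close>
  is bounded below and a large penalty excludes these points. The maximum then falls into
  \<open>U\<close>, which \<open>no_interior_max\<close> forbids.\<close>

lemma psh_max_principle_curve:
  fixes F :: "c2 \<Rightarrow> complex" and G :: "complex \<Rightarrow> complex" and s m :: real
  assumes u: "psh bidisc u" and K: "compact K" "K \<subseteq> bidisc" and U: "open U" "U \<subseteq> K"
    and G: "G holomorphic_on S" "open S" "fst ` K \<subseteq> S" "\<And>x. x \<in> K \<Longrightarrow> G (fst x) \<noteq> 0"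
    and F: "tangent_lines F" "continuous_on UNIV F"
    and bd: "\<And>x. x \<in> K - U \<Longrightarrow> F x = 0 \<Longrightarrow> u x \<le> ereal (s * ln (norm (G (fst x))) + m)"
    and z: "z \<in> K" "F z = 0"
  shows "u z \<le> ereal (s * ln (norm (G (fst z))) + m)"
proof (rule ccontr)
  define q where "q x = s * ln (norm (G (fst x)))" for x :: c2
  assume "\<not> ?thesis"
  then have "ereal (q z + m) < u z" by (simp add: q_def)
  then obtain d where d: "ereal (q z + m) < ereal d" "ereal d < u z"
    using ereal_dense2 by blast
  \<comment> \<open>The gap \<open>4 e\<close> is spent as follows: up to \<open>2 e\<close> on the
    term \<open>e |x|^2\<close>, which is at most \<open>2 e\<close>, and \<open>e\<close> on the
    passage from \<open>m\<close> to \<open>m'\<close>; the rest keeps the inequality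
    strict.\<close>
  define e where "e = (d - q z - m) / 4"
  have e: "e > 0" using d by (simp add: e_def)
  define sq where "sq x = (norm (fst x))\<^sup>2 + (norm (snd x))\<^sup>2" for x :: c2
  have sq: "0 \<le> sq x" "sq x \<le> 2" if "x \<in> K" for x
  proof -
    have "norm (fst x) < 1" "norm (snd x) < 1"
      using that K(2) by (auto simp: bidisc_def unit_disc_def)
    then show "0 \<le> sq x" "sq x \<le> 2"
      using power_le_one[of "norm (fst x)" 2] power_le_one[of "norm (snd x)" 2] by (simp_all add: sq_def)
  qed
  have Gcont: "continuous_on K (\<lambda>x. G (fst x))"
    using continuous_on_compose2[OF holomorphic_on_imp_continuous_on[OF G(1)] continuous_on_fst[OF continuous_on_id] G(3)] .
  have qcont: "continuous_on K q"
    unfolding q_def by (intro continuous_intros Gcont) (use G(4) in auto)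
  have Fcont: "continuous_on K F" by (rule continuous_on_subset[OF F(2)]) simp
  have usc: "usc_on K u" by (rule usc_on_subset[OF psh_imp_usc_on[OF u] K(2)])
  have usc_w: "usc_on K (\<lambda>x. u x + ereal (- q x))"
    by (intro usc_on_add_continuous usc continuous_intros qcont)
  obtain M where M: "\<And>x. x \<in> K \<Longrightarrow> u x + ereal (- q x) \<le> ereal M"
  proof -
    have "K \<noteq> {}" using z by blast
    then obtain x where x: "x \<in> K" "\<And>y. y \<in> K \<Longrightarrow> u y + ereal (- q y) \<le> u x + ereal (- q x)"
      using usc_on_attains_sup[OF K(1) _ usc_w] by auto
    have "u x + ereal (- q x) \<le> ereal (real_of_ereal (u x + ereal (- q x)))"
      using usc_on_not_PInf[OF usc_w x(1)] by (cases "u x + ereal (- q x)") auto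
    then show ?thesis using that x(2) order_trans by blast
  qed
  define m' where "m' = m + e"
  define A where "A = {x \<in> K - U. ereal m' \<le> u x + ereal (- q x)}"
  have "compact (K - U)" using K(1) U(1) by (rule compact_diff)
  then have cA: "compact A"
    unfolding A_def by (intro compact_usc_superlevel usc_on_subset[OF usc_w]) auto
  have FA: "F x \<noteq> 0" if "x \<in> A" for x
  proof
    assume "F x = 0"
    then have "u x \<le> ereal (q x + m)" using that bd by (simp add: A_def q_def)
    then have "u x + ereal (- q x) \<le> ereal m"
      by (cases "u x") auto
    moreover have "ereal m' \<le> u x + ereal (- q x)" using that by (simp add: A_def)
    ultimately have "ereal m' \<le> ereal m" by (rule order_trans[rotated])
    then show False using e by (simp add: m'_def)
  qed
  obtain f0 where f0: "f0 > 0" "\<And>x. x \<in> A \<Longrightarrow> f0 \<le> norm (F x)"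
  proof (cases "A = {}")
    case True
    then show ?thesis using that[of 1] by simp
  next
    case False
    have "continuous_on A (\<lambda>x. norm (F x))"
      by (intro continuous_intros continuous_on_subset[OF F(2)]) simp
    then obtain x where "x \<in> A" "\<And>y. y \<in> A \<Longrightarrow> norm (F x) \<le> norm (F y)"
      using continuous_attains_inf[OF cA False] by blast
    then show ?thesis using that[of "norm (F x)"] FA by simp
  qed
  \<comment> \<open>On \<open>A\<close> the penalty is then at least \<open>|M| + |m'|\<close>. A
    penalised maximum there would exceed \<open>m'\<close> even after this subtraction, hence
    \<open>u - q\<close> would exceed \<open>M\<close>.\<close>
  define N where "N = (\<bar>M\<bar> + \<bar>m'\<bar>) / f0\<^sup>2"
  have N: "N \<ge> 0" by (simp add: N_def)
  define g where "g x = e * sq x - N * (norm (F x))\<^sup>2 - q x" for x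
  have gcont: "continuous_on K g"
    unfolding g_def sq_def by (intro continuous_intros qcont Fcont)
  have "usc_on K (\<lambda>x. u x + ereal (g x))"
    by (intro usc_on_add_continuous usc gcont)
  then obtain p where p: "p \<in> K" and pmax: "\<And>x. x \<in> K \<Longrightarrow> u x + ereal (g x) \<le> u p + ereal (g p)"
    using usc_on_attains_sup[OF K(1)] z(1) by blast
  have "ereal (m + 4 * e) < u z + ereal (- q z)"
    using d(2) by (cases "u z") (auto simp: e_def field_simps)
  also have "- q z \<le> g z"
    using sq(1)[OF z(1)] e by (simp add: g_def z(2))
  then have "u z + ereal (- q z) \<le> u z + ereal (g z)"
    by (intro add_left_mono) simp
  also have "\<dots> \<le> u p + ereal (g p)" by (rule pmax[OF z(1)])
  finally have pbig: "ereal (m + 4 * e) < u p + ereal (g p)" .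
  have "u p \<noteq> \<infinity>" by (rule usc_on_not_PInf[OF usc p])
  with pbig obtain r where r: "u p = ereal r" by (cases "u p") auto
  have big: "m + 4 * e < r + g p" using pbig r by simp
  have "e * sq p \<le> e * 2" using sq(2)[OF p] e by (intro mult_left_mono) auto
  then have big': "m' < r - q p - N * (norm (F p))\<^sup>2"
    using big e unfolding g_def m'_def by linarith
  have "p \<in> U"
  proof (rule ccontr)
    assume "p \<notin> U"
    have "0 \<le> N * (norm (F p))\<^sup>2" using N by simp
    then have "p \<in> A" using big' \<open>p \<notin> U\<close> p r by (simp add: A_def)
    have "\<bar>M\<bar> + \<bar>m'\<bar> = N * f0\<^sup>2" using f0(1) by (simp add: N_def)
    also have "\<dots> \<le> N * (norm (F p))\<^sup>2"
      using f0 \<open>p \<in> A\<close> N by (intro mult_left_mono power_mono) auto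
    finally show False using M[OF p] big' r by simp
  qed
  show False
  proof (rule no_interior_max[OF u U(1) _ \<open>p \<in> U\<close> G(1,2) _ _ F(1) e N _ r])
    show "U \<subseteq> bidisc" using U(2) K(2) by blast
    show "fst p \<in> S" using G(3) p by blast
    show "G (fst p) \<noteq> 0" using G(4) p by blast
    show "g x = e * ((norm (fst x))\<^sup>2 + (norm (snd x))\<^sup>2) - N * (norm (F x))\<^sup>2 - s * ln (norm (G (fst x)))" for x
      by (simp add: g_def sq_def q_def)
    show "u x \<le> ereal (r + g p - g x)" if "x \<in> U" for x
      using pmax[of x] that U(2) r by (cases "u x") auto
  qed
qed

section \<open>Upper bounds for the Green functions\<close>

lemma one_minus_cnj_mult_nonzero:
  assumes "norm w < 1" "norm z < 1"
  shows "1 - cnj w * z \<noteq> 0"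
proof
  assume "1 - cnj w * z = 0"
  then have "norm w * norm z = 1" by (metis complex_mod_cnj norm_mult norm_one right_minus_eq)
  moreover have "norm w * norm z < 1" using mult_strict_mono'[OF assms] by simp
  ultimately show False by simp
qed

lemma Moebius_pythagoras:
  "(norm (1 - cnj w * z))\<^sup>2 - (norm (z - w))\<^sup>2 = (1 - (norm w)\<^sup>2) * (1 - (norm z)\<^sup>2)"
  by (simp only: cmod_power2) (simp add: power2_eq_square algebra_simps)

lemma norm_Moebius_function: "norm (Moebius_function 0 w z) = norm (z - w) / norm (1 - cnj w * z)"
  by (simp add: Moebius_function_simple norm_divide)

lemma one_minus_Moebius_sq:
  assumes "norm w < 1" "norm z < 1"
  shows "1 - (norm (Moebius_function 0 w z))\<^sup>2 = (1 - (norm w)\<^sup>2) * (1 - (norm z)\<^sup>2) / (norm (1 - cnj w * z))\<^sup>2"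
  using Moebius_pythagoras[of w z] one_minus_cnj_mult_nonzero[OF assms]
  by (simp add: norm_Moebius_function power_divide field_simps)

lemma norm_one_minus_cnj_mult_ge:
  assumes "norm z \<le> 1"
  shows "1 - norm w \<le> norm (1 - cnj w * z)"
proof -
  have "norm w * norm z \<le> norm w" using assms by (intro mult_left_le) auto
  then show ?thesis
    using norm_triangle_ineq2[of 1 "cnj w * z"] by (simp add: norm_mult)
qed

section \<open>The curve through the point and the poles\<close>

text \<open>This is \<open>y (y - \<epsilon>) = c b(x)\<close> with the denominator of the Blaschke
  product cleared, hence a polynomial on the whole space, as \<open>tangent_lines\<close>
  demands.\<close>

definition curve_fn :: "complex \<Rightarrow> complex \<Rightarrow> complex \<Rightarrow> c2 \<Rightarrow> complex" where
  "curve_fn a \<epsilon> c p = snd p * (snd p - \<epsilon>) * (1 - (cnj a)\<^sup>2 * (fst p)\<^sup>2) - c * ((fst p)\<^sup>2 - a\<^sup>2)"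

text \<open>The direction is chosen in the kernel of the gradient \<open>(Fx, Fy)\<close>, and
  arbitrarily at a critical point. \<open>Y1\<close>, \<open>X1\<close>, \<open>X2\<close> are
  Taylor coefficients along the line of the factors in \<open>y\<close> and in \<open>x\<close>;
  what is left is divisible by the square of the parameter.\<close>

lemma tangent_lines_curve_fn: "tangent_lines (curve_fn a \<epsilon> c)"
  unfolding tangent_lines_def
proof
  fix p :: c2
  obtain x y where p: "p = (x, y)" by (cases p)
  define X where "X = 1 - (cnj a)\<^sup>2 * x\<^sup>2"
  define Fx where "Fx = - 2 * (cnj a)\<^sup>2 * x * (y * (y - \<epsilon>)) - 2 * c * x"
  define Fy where "Fy = (2 * y - \<epsilon>) * X"
  obtain b1 b2 where b: "(b1, b2) \<noteq> 0" "b1 * Fx + b2 * Fy = 0"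
  proof (cases "Fx = 0 \<and> Fy = 0")
    case True
    then show ?thesis using that[of 1 0] by (simp add: zero_prod_def)
  next
    case False
    then show ?thesis using that[of "- Fy" Fx] by (auto simp: zero_prod_def)
  qed
  define Y1 where "Y1 = b2 * (2 * y - \<epsilon>)"
  define X1 where "X1 = - 2 * (cnj a)\<^sup>2 * x * b1"
  define X2 where "X2 = - (cnj a)\<^sup>2 * b1\<^sup>2"
  define P where "P \<zeta> = y * (y - \<epsilon>) * X2 + Y1 * X1 + b2\<^sup>2 * X - c * b1\<^sup>2 + \<zeta> * (Y1 * X2 + b2\<^sup>2 * X1) + \<zeta>\<^sup>2 * (b2\<^sup>2 * X2)" for \<zeta>
  have "curve_fn a \<epsilon> c (cline p (b1, b2) \<zeta>) = curve_fn a \<epsilon> c p + \<zeta> * (b1 * Fx + b2 * Fy) + \<zeta>\<^sup>2 * P \<zeta>" for \<zeta>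
    unfolding curve_fn_def cline_def p P_def X_def Fx_def Fy_def Y1_def X1_def X2_def
    by (simp add: algebra_simps power2_eq_square)
  moreover have "P holomorphic_on UNIV" unfolding P_def by (intro holomorphic_intros)
  ultimately show "\<exists>b P. b \<noteq> 0 \<and> P holomorphic_on UNIV \<and>
      (\<forall>\<zeta>. curve_fn a \<epsilon> c (cline p b \<zeta>) = curve_fn a \<epsilon> c p + \<zeta>\<^sup>2 * P \<zeta>)"
    using b by (intro exI[of _ "(b1, b2)"] exI[of _ P]) simp
qed

lemma norm_sq_lt_1: "norm (x::complex) < 1 \<Longrightarrow> norm (x\<^sup>2) < 1"
  by (simp add: norm_power power_less_one_iff)

text \<open>The Blaschke product with zeros \<open>a\<close> and \<open>-a\<close>.\<close>

abbreviation blaschke_pm :: "complex \<Rightarrow> complex \<Rightarrow> complex" where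
  "blaschke_pm a x \<equiv> Moebius_function 0 (a\<^sup>2) (x\<^sup>2)"

context
  fixes a \<epsilon> c :: complex
  assumes a: "0 < norm a" "norm a < 1"
begin

lemma blaschke_pm_holomorphic: "(\<lambda>x. blaschke_pm a x) holomorphic_on ball 0 1"
  by (intro holomorphic_on_compose_gen[OF _ Moebius_function_holomorphic[OF norm_sq_lt_1[OF a(2)]], unfolded o_def]
      holomorphic_intros) (auto intro: norm_sq_lt_1)

lemma blaschke_pm_eq_0_iff: "norm x < 1 \<Longrightarrow> blaschke_pm a x = 0 \<longleftrightarrow> x = a \<or> x = - a"
  using one_minus_cnj_mult_nonzero[OF norm_sq_lt_1 norm_sq_lt_1, OF a(2)]
  by (simp add: Moebius_function_simple power2_eq_iff)

lemma norm_blaschke_pm: "norm (blaschke_pm a x) = norm (x - a) * norm (x + a) / norm (1 - (cnj a)\<^sup>2 * x\<^sup>2)"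
proof -
  have "x\<^sup>2 - a\<^sup>2 = (x - a) * (x + a)" by (simp add: power2_eq_square algebra_simps)
  then show ?thesis by (simp add: norm_Moebius_function norm_mult)
qed

lemma one_minus_cnj_sq:
  assumes "norm x < 1"
  shows "1 - (norm a)\<^sup>2 \<le> norm (1 - (cnj a)\<^sup>2 * x\<^sup>2)" "norm (1 - (cnj a)\<^sup>2 * x\<^sup>2) \<le> 2"
    "1 - (cnj a)\<^sup>2 * x\<^sup>2 \<noteq> 0"
proof -
  have x: "norm (x\<^sup>2) < 1" "norm (a\<^sup>2) < 1" using assms a norm_sq_lt_1 by auto
  show 1: "1 - (norm a)\<^sup>2 \<le> norm (1 - (cnj a)\<^sup>2 * x\<^sup>2)"
    using norm_one_minus_cnj_mult_ge[of "x\<^sup>2" "a\<^sup>2"] x by (simp add: norm_power)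
  show "1 - (cnj a)\<^sup>2 * x\<^sup>2 \<noteq> 0" using one_minus_cnj_mult_nonzero[OF x(2,1)] by simp
  have "norm ((cnj a)\<^sup>2 * x\<^sup>2) \<le> 1 * 1"
    unfolding norm_mult using x by (intro mult_mono) (auto simp: norm_power)
  then show "norm (1 - (cnj a)\<^sup>2 * x\<^sup>2) \<le> 2"
    using norm_triangle_ineq4[of 1 "(cnj a)\<^sup>2 * x\<^sup>2"] by simp
qed

lemma curve_fn_eq_0_iff:
  assumes "norm x < 1"
  shows "curve_fn a \<epsilon> c (x, y) = 0 \<longleftrightarrow> y * (y - \<epsilon>) = c * blaschke_pm a x"
  using one_minus_cnj_sq(3)[OF assms] by (auto simp: curve_fn_def Moebius_function_simple field_simps)

lemma norm_blaschke_pm_le: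
  assumes "norm x < 1" "norm (x - a) \<le> \<rho> \<or> norm (x + a) \<le> \<rho>"
  shows "norm (blaschke_pm a x) \<le> 2 * \<rho> / (1 - (norm a)\<^sup>2)"
proof -
  have "0 \<le> \<rho>" using assms(2) norm_ge_zero order_trans by blast
  have "norm (x - a) \<le> 2" "norm (x + a) \<le> 2"
    using norm_triangle_ineq4[of x a] norm_triangle_ineq[of x a] a assms(1) by simp_all
  then have "norm (x - a) * norm (x + a) \<le> 2 * \<rho>"
    using assms(2) mult_mono[of "norm (x - a)" \<rho> "norm (x + a)" 2] mult_mono[of "norm (x - a)" 2 "norm (x + a)" \<rho>]
      \<open>0 \<le> \<rho>\<close> by auto
  moreover have "0 < 1 - (norm a)\<^sup>2" using a by (simp add: power_less_one_iff)
  ultimately show ?thesis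
    unfolding norm_blaschke_pm using one_minus_cnj_sq(1)[OF assms(1)] \<open>0 \<le> \<rho>\<close> by (intro frac_le) auto
qed

text \<open>A uniform form of the fact that a finite Blaschke product has modulus 1 on the circle;
  it controls the part \<open>|x| = R\<close> of the boundary.\<close>

lemma norm_blaschke_pm_ge:
  assumes "norm x < 1"
  shows "1 - (1 - norm x ^ 4) / (1 - (norm a)\<^sup>2)\<^sup>2 \<le> (norm (blaschke_pm a x))\<^sup>2"
proof -
  have x: "norm (x\<^sup>2) < 1" "norm (a\<^sup>2) < 1" using assms a norm_sq_lt_1 by auto
  have pos: "0 < 1 - (norm a)\<^sup>2" using a by (simp add: power_less_one_iff)
  have "1 - (norm (blaschke_pm a x))\<^sup>2 = (1 - (norm (a\<^sup>2))\<^sup>2) * (1 - (norm (x\<^sup>2))\<^sup>2) / (norm (1 - cnj (a\<^sup>2) * x\<^sup>2))\<^sup>2"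
    by (rule one_minus_Moebius_sq[OF x(2,1)])
  also have "\<dots> \<le> (1 - norm x ^ 4) / (1 - (norm a)\<^sup>2)\<^sup>2"
  proof (intro frac_le)
    have "(norm (x\<^sup>2))\<^sup>2 = norm x ^ 4" by (simp add: norm_power flip: power_mult)
    moreover have "norm x ^ 4 \<le> 1" using assms by (simp add: power_le_one)
    ultimately show "(1 - (norm (a\<^sup>2))\<^sup>2) * (1 - (norm (x\<^sup>2))\<^sup>2) \<le> 1 - norm x ^ 4" "0 \<le> 1 - norm x ^ 4"
      by (auto intro!: mult_left_le_one_le simp: power_le_one norm_power a less_imp_le)
    show "(1 - (norm a)\<^sup>2)\<^sup>2 \<le> (norm (1 - cnj (a\<^sup>2) * x\<^sup>2))\<^sup>2"
      using one_minus_cnj_sq(1)[OF assms] pos by (intro power_mono) auto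
  qed (use pos in simp)
  finally show ?thesis by simp
qed

end

text \<open>The comparison function is \<open>(1 - \<delta>) ln |b| + \<delta>\<close> rather than
  \<open>ln |b|\<close>. Close to a pole the surplus \<open>- \<delta> ln |b|\<close> absorbs the
  constant \<open>C\<close>, and near \<open>|x| = 1\<close> the function is nonnegative, hence
  above \<open>u\<close>. Then \<open>\<delta>\<close> tends to 0. The equation for
  \<open>\<gamma>\<close> says that the curve passes through \<open>(0, \<gamma>)\<close>, as
  \<open>b(0) = - a^2\<close>.\<close>

lemma psh_curve_upper_bound:
  fixes a \<epsilon> c \<gamma> :: complex
  assumes a: "0 < norm a" "norm a < 1"
    and u: "psh bidisc u" and neg: "\<And>x. x \<in> bidisc \<Longrightarrow> u x < 0"
    and c: "norm c + norm \<epsilon> < 1" and \<gamma>: "norm \<gamma> < 1" "\<gamma> * (\<gamma> - \<epsilon>) = - c * a\<^sup>2"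
    and \<rho>0: "\<rho>0 > 0"
    and pole: "\<And>x y. curve_fn a \<epsilon> c (x, y) = 0 \<Longrightarrow> norm x < 1 \<Longrightarrow> norm y < 1 \<Longrightarrow> x \<noteq> a \<Longrightarrow> x \<noteq> - a \<Longrightarrow>
       norm (x - a) < \<rho>0 \<or> norm (x + a) < \<rho>0 \<Longrightarrow>
       u (x, y) \<le> ereal (ln (norm (blaschke_pm a x)) + C)"
  shows "u (0, \<gamma>) \<le> ereal (2 * ln (norm a))"
proof -
  define b where "b x = blaschke_pm a x" for x
  define D where "D = (1 - (norm a)\<^sup>2)"
  have D: "0 < D" using a by (simp add: D_def power_less_one_iff)
  have main: "u (0, \<gamma>) \<le> ereal ((1 - \<delta>) * (2 * ln (norm a)) + \<delta>)" if \<delta>: "0 < \<delta>" "\<delta> < 1" for \<delta>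
  proof -
    have "((\<lambda>R. R * (R - norm \<epsilon>)) \<longlongrightarrow> 1 * (1 - norm \<epsilon>)) (at_left 1)"
      by (intro tendsto_intros)
    then have e1: "\<forall>\<^sub>F R in at_left 1. norm c < R * (R - norm \<epsilon>)"
      by (rule order_tendstoD(1)) (use c in simp)
    have "((\<lambda>R. 1 - (1 - R ^ 4) / D\<^sup>2) \<longlongrightarrow> 1 - (1 - 1 ^ 4) / D\<^sup>2) (at_left (1::real))"
      using D by (intro tendsto_intros) auto
    then have e2: "\<forall>\<^sub>F R in at_left 1. (exp (- \<delta>))\<^sup>2 < 1 - (1 - R ^ 4) / D\<^sup>2"
      by (rule order_tendstoD(1)) (use \<delta> in \<open>simp add: power_less_one_iff\<close>)
    have "norm \<epsilon> < 1" using c norm_ge_zero[of c] by linarith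
    then have "max (norm \<gamma>) (norm \<epsilon>) < 1" using \<gamma>(1) by simp
    then have e3: "\<forall>\<^sub>F R::real in at_left 1. R \<in> {max (norm \<gamma>) (norm \<epsilon>)<..<1}"
      by (rule eventually_at_left_real)
    from eventually_happens'[OF _ eventually_conj[OF e1 eventually_conj[OF e2 e3]]]
    obtain R where R: "norm c < R * (R - norm \<epsilon>)" "(exp (- \<delta>))\<^sup>2 < 1 - (1 - R ^ 4) / D\<^sup>2"
      "norm \<gamma> < R" "norm \<epsilon> < R" "R < 1" by auto
    have R0: "0 < R" using R(3) norm_ge_zero le_less_trans by blast
    \<comment> \<open>The three bounds serve, in this order, the hypothesis at the poles, the
      membership of \<open>(0, \<gamma>)\<close> in \<open>K\<close>, and the estimate
      \<open>ln |b| \<le> 1 - C / \<delta>\<close> on the small circles.\<close>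
    define \<rho> where "\<rho> = Min {\<rho>0 / 2, norm a, D * exp (1 - C / \<delta>) / 2}"
    have \<rho>: "0 < \<rho>" "\<rho> < \<rho>0" "\<rho> \<le> norm a" "2 * \<rho> / D \<le> exp (1 - C / \<delta>)"
      using \<rho>0 a D by (auto simp: \<rho>_def min_def field_simps)
    define K :: "c2 set" where "K = {p. norm (fst p) \<le> R \<and> norm (snd p) \<le> R \<and> \<rho> \<le> norm (fst p - a) \<and> \<rho> \<le> norm (fst p + a)}"
    define U :: "c2 set" where "U = {p. norm (fst p) < R \<and> norm (snd p) < R \<and> \<rho> < norm (fst p - a) \<and> \<rho> < norm (fst p + a)}"
    have "K = (cball 0 R \<times> cball 0 R) \<inter> {p. \<rho> \<le> norm (fst p - a) \<and> \<rho> \<le> norm (fst p + a)}"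
      by (auto simp: K_def)
    moreover have "closed {p. \<rho> \<le> norm (fst p - a) \<and> \<rho> \<le> norm (fst p + a)}"
      by (intro closed_Collect_conj closed_Collect_le continuous_intros)
    ultimately have K: "compact K"
      using compact_Int_closed[OF compact_Times[OF compact_cball compact_cball]] by simp
    have U: "open U" unfolding U_def
      by (intro open_Collect_conj open_Collect_less continuous_intros)
    have Kdisc: "norm (fst p) < 1" "norm (snd p) < 1" "fst p \<noteq> a" "fst p \<noteq> - a" if "p \<in> K" for p
      using that R(5) \<rho>(1) by (auto simp: K_def)
    have "u (0, \<gamma>) \<le> ereal ((1 - \<delta>) * ln (norm (b (fst (0::complex, \<gamma>)))) + \<delta>)"
    proof (rule psh_max_principle_curve[OF u K _ U])
      show "K \<subseteq> bidisc" using Kdisc by (auto simp: bidisc_def unit_disc_def)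
      show "U \<subseteq> K" by (auto simp: U_def K_def)
      show "b holomorphic_on ball 0 1" unfolding b_def by (rule blaschke_pm_holomorphic[OF a])
      show "fst ` K \<subseteq> ball 0 1" using Kdisc by auto
      show "b (fst x) \<noteq> 0" if "x \<in> K" for x
        unfolding b_def using blaschke_pm_eq_0_iff[OF a, of "fst x"] Kdisc[OF that] by simp
      show "tangent_lines (curve_fn a \<epsilon> c)" by (rule tangent_lines_curve_fn)
      show "continuous_on UNIV (curve_fn a \<epsilon> c)"
        unfolding curve_fn_def by (intro continuous_intros)
      show "(0, \<gamma>) \<in> K" using R R0 \<rho> by (simp add: K_def)
      show "curve_fn a \<epsilon> c (0, \<gamma>) = 0" using \<gamma>(2) by (simp add: curve_fn_def)
      fix p assume p: "p \<in> K - U" and F0: "curve_fn a \<epsilon> c p = 0"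
      obtain x y where xy: "p = (x, y)" by (cases p)
      have x: "norm x < 1" "norm y < 1" "x \<noteq> a" "x \<noteq> - a" using Kdisc[of p] p xy by auto
      have bx: "norm (b x) > 0" using blaschke_pm_eq_0_iff[OF a x(1)] x by (simp add: b_def)
      consider "norm x = R" | "norm y = R" | "norm (x - a) = \<rho> \<or> norm (x + a) = \<rho>"
        using p by (auto simp: xy K_def U_def)
      then have "u p \<le> ereal ((1 - \<delta>) * ln (norm (b x)) + \<delta>)"
      proof cases
        case 1
        have "(exp (- \<delta>))\<^sup>2 \<le> (norm (b x))\<^sup>2"
          using R(2) norm_blaschke_pm_ge[OF a x(1)] unfolding 1 b_def D_def by linarith
        then have "exp (- \<delta>) \<le> norm (b x)"
          by (rule power2_le_imp_le) simp
        then have "- \<delta> \<le> ln (norm (b x))" using ln_ge_iff[OF bx] by simp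
        then have "(1 - \<delta>) * (- \<delta>) \<le> (1 - \<delta>) * ln (norm (b x))"
          using \<delta> by (intro mult_left_mono) auto
        moreover have "- \<delta> \<le> (1 - \<delta>) * (- \<delta>)" using \<delta> by (simp add: algebra_simps)
        ultimately have "0 \<le> (1 - \<delta>) * ln (norm (b x)) + \<delta>" by linarith
        moreover have "u p < 0" using x by (intro neg) (simp add: xy bidisc_def unit_disc_def)
        ultimately have "u p < ereal ((1 - \<delta>) * ln (norm (b x)) + \<delta>)"
          by (simp add: less_le_trans)
        then show ?thesis by (rule less_imp_le)
      next
        \<comment> \<open>This case is void: \<open>|y| = R\<close> would force
          \<open>R (R - |\<epsilon>|) \<le> |c|\<close>, against the choice of
          \<open>R\<close>.\<close>
        case 2
        have "y * (y - \<epsilon>) = c * b x"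
          using F0 curve_fn_eq_0_iff[OF a x(1)] by (simp add: xy b_def)
        then have "norm y * norm (y - \<epsilon>) = norm c * norm (b x)" by (metis norm_mult)
        also have "\<dots> \<le> norm c * 1"
          unfolding b_def using less_imp_le[OF Moebius_function_norm_lt_1[OF norm_sq_lt_1[OF a(2)] norm_sq_lt_1[OF x(1)]]]
          by (intro mult_left_mono) auto
        finally have "R * norm (y - \<epsilon>) \<le> norm c" using 2 by simp
        moreover have "R * (R - norm \<epsilon>) \<le> R * norm (y - \<epsilon>)"
          using norm_triangle_ineq2[of y \<epsilon>] 2 R0 by (intro mult_left_mono) auto
        ultimately show ?thesis using R(1) by linarith
      next
        case 3
        have "norm (b x) \<le> 2 * \<rho> / D"
          unfolding b_def D_def by (rule norm_blaschke_pm_le[OF a x(1)]) (use 3 in auto)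
        also have "\<dots> \<le> exp (1 - C / \<delta>)" by (rule \<rho>)
        finally have "ln (norm (b x)) \<le> 1 - C / \<delta>" using ln_le_cancel_iff[OF bx exp_gt_zero] by simp
        then have "\<delta> * ln (norm (b x)) \<le> \<delta> * (1 - C / \<delta>)" using \<delta> by (intro mult_left_mono) auto
        then have "ln (norm (b x)) + C \<le> (1 - \<delta>) * ln (norm (b x)) + \<delta>"
          using \<delta> by (simp add: algebra_simps)
        moreover have "u p \<le> ereal (ln (norm (b x)) + C)"
          unfolding xy b_def by (rule pole) (use F0 x 3 \<rho>(2) xy in auto)
        ultimately show ?thesis using order_trans[OF _ iffD2[OF ereal_less_eq(3)]] by simp
      qed
      then show "u p \<le> ereal ((1 - \<delta>) * ln (norm (b (fst p))) + \<delta>)" by (simp add: xy)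
    qed simp
    moreover have "norm (b 0) = (norm a)\<^sup>2" by (simp add: b_def Moebius_function_simple norm_power)
    ultimately show ?thesis using a by (simp add: ln_realpow)
  qed
  show ?thesis
  proof (rule ereal_le_epsilon2)
    fix e :: real assume e: "0 < e"
    define L where "L = - 2 * ln (norm a)"
    have L: "L > 0" using a by (simp add: L_def)
    \<comment> \<open>Replacing \<open>- L\<close> by \<open>- (1 - \<delta>) L + \<delta>\<close>
      costs \<open>\<delta> (1 + L)\<close>, which has to be at most \<open>e\<close>.\<close>
    define \<delta> where "\<delta> = min (1/2) (e / (1 + L))"
    have \<delta>: "0 < \<delta>" "\<delta> < 1" "\<delta> \<le> e / (1 + L)" using e L by (auto simp: \<delta>_def)
    have "\<delta> * (1 + L) \<le> e" using \<delta>(3) L by (simp add: field_simps)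
    then have "(1 - \<delta>) * (2 * ln (norm a)) + \<delta> \<le> 2 * ln (norm a) + e"
      by (simp add: L_def algebra_simps)
    then show "u (0, \<gamma>) \<le> ereal (2 * ln (norm a)) + ereal e"
      using main[OF \<delta>(1,2)] by (simp add: order_trans[OF _ iffD2[OF ereal_less_eq(3)]])
  qed
qed

lemma uniform_local_upper_bound:
  fixes u :: "'a::metric_space \<Rightarrow> ereal"
  assumes S: "finite S" "S \<noteq> {}"
    and ev: "\<And>s. s \<in> S \<Longrightarrow> \<exists>C::real. \<forall>\<^sub>F x in nhds s. u x \<le> h s x + ereal C"
  shows "\<exists>C::real. \<exists>e>0. \<forall>s\<in>S. \<forall>x. dist x s < e \<longrightarrow> u x \<le> h s x + ereal C"
proof -
  have "\<forall>s\<in>S. \<exists>C::real. \<exists>e>0. \<forall>x. dist x s < e \<longrightarrow> u x \<le> h s x + ereal C"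
    using ev unfolding eventually_nhds_metric by blast
  then obtain C where "\<forall>s\<in>S. \<exists>e>0. \<forall>x. dist x s < e \<longrightarrow> u x \<le> h s x + ereal (C s)"
    by (auto dest!: bchoice)
  then obtain e where e: "\<forall>s\<in>S. e s > 0 \<and> (\<forall>x. dist x s < e s \<longrightarrow> u x \<le> h s x + ereal (C s))"
    by (auto dest!: bchoice)
  have "u x \<le> h s x + ereal (Max (C ` S))" if "s \<in> S" "dist x s < Min (e ` S)" for s x
  proof -
    have "dist x s < e s" using that S by auto
    then have "u x \<le> h s x + ereal (C s)" using e that(1) by blast
    also have "\<dots> \<le> h s x + ereal (Max (C ` S))"
      using S that(1) by (intro add_left_mono) simp
    finally show ?thesis .
  qed
  moreover have "Min (e ` S) > 0" using S e by simp
  ultimately show ?thesis by blast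
qed

text \<open>Near one zero of the Blaschke product the factor of the other zero is at least
  \<open>|a|\<close> and the denominator at most 2, so \<open>|b|\<close> controls the distance to
  the near zero.\<close>

lemma norm_diff_le_blaschke_pm:
  assumes a: "0 < norm a" "norm a < 1" and \<sigma>: "\<sigma> = a \<or> \<sigma> = - a" and x: "norm x < 1" "norm (x - \<sigma>) < norm a"
  shows "norm (x - \<sigma>) \<le> 2 / norm a * norm (blaschke_pm a x)"
proof -
  define d where "d = norm (1 - (cnj a)\<^sup>2 * x\<^sup>2)"
  have d: "0 < d" "d \<le> 2" using one_minus_cnj_sq[OF a x(1)] by (auto simp: d_def)
  have "norm (x + \<sigma>) \<ge> norm (2 * \<sigma>) - norm (x - \<sigma>)"
    using norm_triangle_ineq4[of "x + \<sigma>" "x - \<sigma>"] by (simp add: algebra_simps)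
  then have ge: "norm (x + \<sigma>) \<ge> norm a" using \<sigma> x(2) by (auto simp: norm_mult)
  have "norm (x - \<sigma>) * d \<le> norm (x - \<sigma>) * 2" using d by (intro mult_left_mono) auto
  also have "\<dots> = 2 / norm a * (norm (x - \<sigma>) * norm a)" using a by simp
  also have "\<dots> \<le> 2 / norm a * (norm (x - \<sigma>) * norm (x + \<sigma>))"
    by (intro mult_left_mono ge) auto
  also have "norm (x - \<sigma>) * norm (x + \<sigma>) = norm (x - a) * norm (x + a)" using \<sigma> by auto
  finally show ?thesis
    unfolding norm_blaschke_pm[OF a] d_def[symmetric] times_divide_eq_right using d(1) by (subst pos_le_divide_eq)
qed

lemma eln_le_ln:
  assumes "t \<le> K * s" "0 \<le> t" "0 < s" "0 < K"
  shows "eln t \<le> ereal (ln s + ln K)"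
proof (cases "t = 0")
  case False
  then have "ln t \<le> ln (K * s)" using assms by simp
  then show ?thesis using assms False by (simp add: eln_def ln_mult)
qed (simp add: eln_def)

text \<open>On the curve with \<open>\<epsilon> = 0\<close> one has
  \<open>|y|^2 \<le> |b(x)|\<close>, and \<open>|x - \<sigma>|\<close> is at most a constant times
  \<open>|b(x)|\<close>. Hence both entries of the maximum in \<open>PsiV\<close>, the doubled
  logarithm included, are at most \<open>ln |b| + O(1)\<close>.\<close>

lemma G_aVbV_le:
  assumes a: "norm a < 1" and \<gamma>: "norm \<gamma> < norm a"
  shows "G_aVbV a (- a) (0, \<gamma>) \<le> ereal (2 * ln (norm a))"
  unfolding G_aVbV_def
proof (rule Sup_least, clarify)
  fix u C1 C2
  assume u: "psh bidisc u" and neg: "\<forall>x\<in>bidisc. u x < 0"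
    and C1: "\<forall>\<^sub>F x in nhds (a, 0). u x \<le> PsiV (x - (a, 0)) + ereal C1"
    and C2: "\<forall>\<^sub>F x in nhds (- a, 0). u x \<le> PsiV (x - (- a, 0)) + ereal C2"
  have a0: "0 < norm a" using \<gamma> norm_ge_zero le_less_trans by blast
  define D where "D = (1 - (norm a)\<^sup>2)"
  have D: "0 < D" using a by (simp add: D_def power_less_one_iff)
  have "\<exists>C::real. \<exists>e>0. \<forall>s\<in>{(a,0), (-a,0)}. \<forall>x. dist x s < e \<longrightarrow> u x \<le> PsiV (x - s) + ereal C"
    using C1 C2 by (intro uniform_local_upper_bound) auto
  then obtain C e where e: "e > 0" and
    ub': "\<forall>s\<in>{(a,0), (-a,0)}. \<forall>x. dist x s < e \<longrightarrow> u x \<le> PsiV (x - s) + ereal C"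
    by blast
  have ub: "u x \<le> PsiV (x - (\<sigma>, 0)) + ereal C" if "\<sigma> = a \<or> \<sigma> = - a" "dist x (\<sigma>, 0) < e" for x \<sigma>
    using ub'[rule_format, of "(\<sigma>, 0)" x] that by auto
  \<comment> \<open>On the curve \<open>|x - \<sigma>| < \<rho>\<close> gives
    \<open>|y|^2 \<le> 2 \<rho> / D\<close>, so the sum bounds the distance from
    \<open>(x, y)\<close> to the pole.\<close>
  have "((\<lambda>\<rho>. \<rho> + sqrt (2 * \<rho> / D)) \<longlongrightarrow> 0 + sqrt (2 * 0 / D)) (at_right 0)"
    using D by (intro tendsto_intros) auto
  then have e1: "\<forall>\<^sub>F \<rho> in at_right 0. \<rho> + sqrt (2 * \<rho> / D) < e"
    using e by (intro order_tendstoD(2)[where y = "0 + sqrt (2 * 0 / D)"]) auto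
  from eventually_happens'[OF _ eventually_conj[OF e1 eventually_at_right_real[OF a0]]]
  obtain \<rho> where \<rho>: "0 < \<rho>" "\<rho> < norm a" "\<rho> + sqrt (2 * \<rho> / D) < e" by auto
  define c where "c = - \<gamma>\<^sup>2 / a\<^sup>2"
  have "(norm \<gamma>)\<^sup>2 < (norm a)\<^sup>2" using \<gamma> by (intro power_strict_mono) auto
  then have c: "norm c < 1" using a0 by (simp add: c_def norm_divide norm_power)
  show "u (0, \<gamma>) \<le> ereal (2 * ln (norm a))"
  proof (rule psh_curve_upper_bound[OF a0 a u, where \<epsilon> = 0 and c = c and ?\<rho>0.0 = \<rho> and C = "ln (2 / norm a) + C"])
    show "u x < 0" if "x \<in> bidisc" for x using neg that by blast
    show "norm \<gamma> < 1" using a \<gamma> by simp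
    show "\<gamma> * (\<gamma> - 0) = - c * a\<^sup>2" using a0 by (simp add: c_def power2_eq_square)
    fix x y assume F: "curve_fn a 0 c (x, y) = 0" and x: "norm x < 1" "x \<noteq> a" "x \<noteq> - a"
      and near: "norm (x - a) < \<rho> \<or> norm (x + a) < \<rho>"
    define b where "b = blaschke_pm a x"
    have b: "0 < norm b" using blaschke_pm_eq_0_iff[OF a0 a x(1)] x by (simp add: b_def)
    have "y * y = c * b" using F curve_fn_eq_0_iff[OF a0 a x(1)] by (simp add: b_def)
    then have "(norm y)\<^sup>2 = norm c * norm b" by (metis norm_mult power2_eq_square)
    also have "\<dots> \<le> 1 * norm b" using c by (intro mult_right_mono) auto
    finally have y: "(norm y)\<^sup>2 \<le> norm b" by simp
    have "norm b \<le> 2 * \<rho> / D"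
      unfolding b_def D_def by (rule norm_blaschke_pm_le[OF a0 a x(1)]) (use near in auto)
    with y have "norm y \<le> sqrt (2 * \<rho> / D)" by (intro real_le_rsqrt) simp
    obtain \<sigma> where \<sigma>: "\<sigma> = a \<or> \<sigma> = - a" "norm (x - \<sigma>) < \<rho>"
      using near by (metis diff_minus_eq_add)
    have "dist (x, y) (\<sigma>, 0) \<le> norm (x - \<sigma>) + norm y"
      by (metis diff_zero dist_norm diff_Pair norm_Pair_le)
    with \<rho> \<sigma> \<open>norm y \<le> sqrt (2 * \<rho> / D)\<close> have "dist (x, y) (\<sigma>, 0) < e" by linarith
    then have "u (x, y) \<le> PsiV ((x, y) - (\<sigma>, 0)) + ereal C" by (rule ub[OF \<sigma>(1)])
    also have "PsiV ((x, y) - (\<sigma>, 0)) \<le> ereal (ln (norm b) + ln (2 / norm a))"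
    proof -
      have "norm (x - \<sigma>) \<le> 2 / norm a * norm b"
        unfolding b_def by (rule norm_diff_le_blaschke_pm[OF a0 a \<sigma>(1) x(1)]) (use \<sigma> \<rho> in simp)
      then have 1: "eln (norm (x - \<sigma>)) \<le> ereal (ln (norm b) + ln (2 / norm a))"
        using b a0 by (intro eln_le_ln) auto
      have 2: "2 * eln (norm y) \<le> ereal (ln (norm b) + ln (2 / norm a))"
      proof (cases "y = 0")
        case False
        have "2 * ln (norm y) = ln ((norm y)\<^sup>2)" using False by (simp add: ln_realpow)
        also have "\<dots> \<le> ln (norm b)" using y False b by simp
        also have "\<dots> \<le> ln (norm b) + ln (2 / norm a)" using a a0 by simp
        finally show ?thesis using False by (simp add: eln_def)
      qed (simp add: eln_def)
      show ?thesis using 1 2 by (simp add: PsiV_def)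
    qed
    finally show "u (x, y) \<le> ereal (ln (norm (blaschke_pm a x)) + (ln (2 / norm a) + C))"
      by (simp add: add_right_mono b_def add.assoc)
  qed (use c \<rho> in auto)
qed

text \<open>For \<open>\<epsilon> \<noteq> 0\<close> the two heights are separated, so near each
  pole the curve leaves both coordinates controlled by a multiple of \<open>|b|\<close>. The
  multiple depends on \<open>\<epsilon>\<close>, but only as an additive constant that
  \<open>psh_curve_upper_bound\<close> discards.\<close>

lemma green_le:
  assumes a: "norm a < 1" "0 < norm a" and \<gamma>: "norm \<gamma> < 1" and \<epsilon>: "\<epsilon> \<noteq> 0"
    and c: "norm (\<gamma> * (\<gamma> - \<epsilon>)) / (norm a)\<^sup>2 + norm \<epsilon> < 1"
  shows "green [(a,0), (-a,0), (-a,\<epsilon>), (a,\<epsilon>)] (0, \<gamma>) \<le> ereal (2 * ln (norm a))"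
  unfolding green_def
proof (rule Sup_least, clarify)
  fix u
  assume u: "psh bidisc u" and neg: "\<forall>x\<in>bidisc. u x < 0"
    and poles: "\<forall>j<length [(a,0), (-a,0), (-a,\<epsilon>), (a,\<epsilon>)]. \<exists>C::real. \<forall>\<^sub>F x in nhds ([(a,0), (-a,0), (-a,\<epsilon>), (a,\<epsilon>)] ! j).
       u x \<le> eln (norm (x - [(a,0), (-a,0), (-a,\<epsilon>), (a,\<epsilon>)] ! j)) + ereal C"
  define D where "D = (1 - (norm a)\<^sup>2)"
  have D: "0 < D" using a by (simp add: D_def power_less_one_iff)
  have "\<exists>C::real. \<exists>e>0. \<forall>s\<in>{a, -a} \<times> {0, \<epsilon>}. \<forall>x. dist x s < e \<longrightarrow> u x \<le> eln (norm (x - s)) + ereal C"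
    using poles[rule_format, of 0] poles[rule_format, of 1] poles[rule_format, of 2] poles[rule_format, of 3]
    by (intro uniform_local_upper_bound) (auto simp: numeral_3_eq_3)
  then obtain C e where e: "e > 0" and
    ub': "\<forall>s\<in>{a, -a} \<times> {0, \<epsilon>}. \<forall>x. dist x s < e \<longrightarrow> u x \<le> eln (norm (x - s)) + ereal C"
    by blast
  have ub: "u x \<le> eln (norm (x - (\<sigma>, \<tau>))) + ereal C"
    if "\<sigma> = a \<or> \<sigma> = - a" "\<tau> = 0 \<or> \<tau> = \<epsilon>" "dist x (\<sigma>, \<tau>) < e" for x \<sigma> \<tau>
    using ub'[rule_format, of "(\<sigma>, \<tau>)" x] that by auto
  define K where "K = 2 / norm a + 2 / norm \<epsilon>"
  have K: "K > 0" using a \<epsilon> by (simp add: K_def add_pos_pos)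
  \<comment> \<open>Since \<open>|b| \<le> 2 \<rho> / D\<close>, this makes \<open>K |b|\<close>,
    which bounds the distance to the pole, at most \<open>e / 2\<close>.\<close>
  define \<rho> where "\<rho> = min (norm a) (e * D / (4 * K))"
  have \<rho>: "0 < \<rho>" "\<rho> \<le> norm a" "\<rho> \<le> e * D / (4 * K)" using a e D K by (auto simp: \<rho>_def)
  have "K * (2 * \<rho> / D) \<le> e / 2" using \<rho>(3) K D by (simp add: field_simps)
  then have Ke: "K * (2 * \<rho> / D) < e" using e by simp
  define c where "c = - (\<gamma> * (\<gamma> - \<epsilon>)) / a\<^sup>2"
  have nc: "norm c + norm \<epsilon> < 1" using c by (simp add: c_def norm_divide norm_power norm_mult)
  then have "norm c \<le> 1" using norm_ge_zero[of \<epsilon>] by linarith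
  show "u (0, \<gamma>) \<le> ereal (2 * ln (norm a))"
  proof (rule psh_curve_upper_bound[OF a(2,1) u, where \<epsilon> = \<epsilon> and c = c and ?\<rho>0.0 = \<rho> and C = "ln K + C"])
    show "u x < 0" if "x \<in> bidisc" for x using neg that by blast
    show "\<gamma> * (\<gamma> - \<epsilon>) = - c * a\<^sup>2" using a by (simp add: c_def)
    fix x y assume F: "curve_fn a \<epsilon> c (x, y) = 0" and x: "norm x < 1" "x \<noteq> a" "x \<noteq> - a"
      and near: "norm (x - a) < \<rho> \<or> norm (x + a) < \<rho>"
    define b where "b = blaschke_pm a x"
    have b: "0 < norm b" using blaschke_pm_eq_0_iff[OF a(2,1) x(1)] x by (simp add: b_def)
    have "y * (y - \<epsilon>) = c * b" using F curve_fn_eq_0_iff[OF a(2,1) x(1)] by (simp add: b_def)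
    then have "norm y * norm (y - \<epsilon>) = norm c * norm b" by (metis norm_mult)
    also have "\<dots> \<le> 1 * norm b" using \<open>norm c \<le> 1\<close> by (intro mult_right_mono) auto
    finally have yy: "norm y * norm (y - \<epsilon>) \<le> norm b" by simp
    \<comment> \<open>\<open>\<tau>\<close> is the nearer of the heights 0 and
      \<open>\<epsilon>\<close>; the distance to the other one is at least
      \<open>|\<epsilon>| / 2\<close>.\<close>
    obtain \<tau> where \<tau>: "\<tau> = 0 \<or> \<tau> = \<epsilon>" "norm (y - \<tau>) * (norm \<epsilon> / 2) \<le> norm b"
    proof (cases "norm y \<le> norm (y - \<epsilon>)")
      case True
      then have "norm \<epsilon> / 2 \<le> norm (y - \<epsilon>)" using norm_triangle_ineq4[of y "y - \<epsilon>"] by simp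
      then have "norm y * (norm \<epsilon> / 2) \<le> norm b"
        using yy mult_left_mono[of _ _ "norm y"] by (meson norm_ge_zero order_trans)
      then show ?thesis using that[of 0] by simp
    next
      case False
      then have "norm \<epsilon> / 2 \<le> norm y" using norm_triangle_ineq4[of y "y - \<epsilon>"] by simp
      then have "norm (y - \<epsilon>) * (norm \<epsilon> / 2) \<le> norm (y - \<epsilon>) * norm y"
        by (intro mult_left_mono) auto
      also have "\<dots> \<le> norm b" using yy by (simp only: mult.commute)
      finally have "norm (y - \<epsilon>) * (norm \<epsilon> / 2) \<le> norm b" .
      then show ?thesis using that[of \<epsilon>] by simp
    qed
    have y: "norm (y - \<tau>) \<le> 2 / norm \<epsilon> * norm b" using \<tau>(2) \<epsilon> by (simp add: field_simps)
    have "norm b \<le> 2 * \<rho> / D"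
      unfolding b_def D_def by (rule norm_blaschke_pm_le[OF a(2,1) x(1)]) (use near in auto)
    then have "K * norm b \<le> K * (2 * \<rho> / D)" using K by (intro mult_left_mono) auto
    obtain \<sigma> where \<sigma>: "\<sigma> = a \<or> \<sigma> = - a" "norm (x - \<sigma>) < \<rho>"
      using near by (metis diff_minus_eq_add)
    have "norm (x - \<sigma>) \<le> 2 / norm a * norm b"
      unfolding b_def by (rule norm_diff_le_blaschke_pm[OF a(2,1) \<sigma>(1) x(1)]) (use \<sigma> \<rho> in simp)
    moreover have "norm ((x, y) - (\<sigma>, \<tau>)) \<le> norm (x - \<sigma>) + norm (y - \<tau>)"
      by (metis diff_Pair norm_Pair_le)
    ultimately have le: "norm ((x, y) - (\<sigma>, \<tau>)) \<le> K * norm b"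
      using y by (simp add: K_def algebra_simps)
    then have "dist (x, y) (\<sigma>, \<tau>) < e"
      using Ke \<open>K * norm b \<le> K * (2 * \<rho> / D)\<close> by (simp add: dist_norm)
    then have "u (x, y) \<le> eln (norm ((x, y) - (\<sigma>, \<tau>))) + ereal C" by (rule ub[OF \<sigma>(1) \<tau>(1)])
    also have "eln (norm ((x, y) - (\<sigma>, \<tau>))) \<le> ereal (ln (norm b) + ln K)"
      by (rule eln_le_ln[OF le]) (use b K in auto)
    finally show "u (x, y) \<le> ereal (ln (norm (blaschke_pm a x)) + (ln K + C))"
      by (simp add: add_right_mono b_def add.assoc)
  qed (use nc \<rho> \<gamma> in auto)
qed

section \<open>Schwarz--Pick estimates\<close>

lemma Moebius_holomorphic_compose:
  assumes "f holomorphic_on ball 0 1" "\<And>z. norm z < 1 \<Longrightarrow> norm (f z) < 1" "norm w < 1"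
  shows "(\<lambda>z. Moebius_function 0 w (f z)) holomorphic_on ball 0 1"
  using assms(2)
  by (intro holomorphic_on_compose_gen[OF assms(1) Moebius_function_holomorphic[OF assms(3)], unfolded o_def]) auto

text \<open>The Schwarz lemma is applied after moving \<open>p\<close> to the centre. It wants a
  strict bound, so \<open>f\<close> is divided by \<open>M' > M\<close> and \<open>M'\<close> tends
  to \<open>M\<close> afterwards; this also covers \<open>M = 0\<close>.\<close>

lemma Schwarz_Pick_bound:
  fixes f :: "complex \<Rightarrow> complex"
  assumes f: "f holomorphic_on ball 0 1" and le: "\<And>z. norm z < 1 \<Longrightarrow> norm (f z) \<le> M"
    and p: "norm p < 1" "f p = 0" and z: "norm z < 1"
  shows "norm (f z) \<le> M * norm (Moebius_function 0 p z)"
proof -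
  have M0: "0 \<le> M" using le[OF p(1)] norm_ge_zero order_trans by blast
  have "norm (f z) \<le> M' * norm (Moebius_function 0 p z)" if M': "M < M'" for M'
  proof -
    have pos: "0 < M'" using M' M0 by simp
    define \<psi> where "\<psi> = Moebius_function 0 (- p)"
    have \<psi>lt: "norm (\<psi> w) < 1" if "norm w < 1" for w
      unfolding \<psi>_def using p(1) that by (intro Moebius_function_norm_lt_1) auto
    define k where "k w = f (\<psi> w) / of_real M'" for w
    have "k holomorphic_on ball 0 1"
      unfolding k_def \<psi>_def using p(1) pos \<psi>lt
      by (intro holomorphic_intros holomorphic_on_compose_gen[OF Moebius_function_holomorphic f, unfolded o_def])
        (auto simp: \<psi>_def)
    moreover have "k 0 = 0" using p by (simp add: k_def \<psi>_def Moebius_function_of_zero)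
    moreover have "norm (k w) < 1" if "norm w < 1" for w
      using le[OF \<psi>lt[OF that]] M' pos by (simp add: k_def norm_divide)
    moreover have lt: "norm (Moebius_function 0 p z) < 1"
      using p(1) z by (rule Moebius_function_norm_lt_1)
    ultimately have "norm (k (Moebius_function 0 p z)) \<le> norm (Moebius_function 0 p z)"
      by (rule Schwarz_Lemma(1))
    moreover have "\<psi> (Moebius_function 0 p z) = z"
      unfolding \<psi>_def using p(1) z by (intro Moebius_function_compose) auto
    ultimately show ?thesis using pos by (simp add: k_def norm_divide field_simps)
  qed
  then have "\<forall>\<^sub>F M' in at_right M. norm (f z) \<le> M' * norm (Moebius_function 0 p z)"
    by (auto intro: eventually_mono[OF eventually_at_right_less])
  moreover have "((\<lambda>M'. M' * norm (Moebius_function 0 p z)) \<longlongrightarrow> M * norm (Moebius_function 0 p z)) (at_right M)"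
    by (intro tendsto_intros)
  ultimately show ?thesis by (intro tendsto_lowerbound) auto
qed

lemma Blaschke_factor:
  fixes f :: "complex \<Rightarrow> complex"
  assumes f: "f holomorphic_on ball 0 1" and le: "\<And>z. norm z < 1 \<Longrightarrow> norm (f z) \<le> M"
    and p: "norm p < 1" "f p = 0"
  obtains h where "h holomorphic_on ball 0 1" "\<And>z. norm z < 1 \<Longrightarrow> norm (h z) \<le> M"
    "\<And>z. norm z < 1 \<Longrightarrow> f z = Moebius_function 0 p z * h z"
proof
  \<comment> \<open>The difference quotient, with the derivative as its value at \<open>p\<close>,
    removes the singularity of the division. The bound at \<open>p\<close> itself then follows by
    continuity.\<close>
  define h where "h z = (1 - cnj p * z) * (if z = p then deriv f p else (f z - f p) / (z - p))" for z
  show hol: "h holomorphic_on ball 0 1"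
    unfolding h_def by (intro holomorphic_intros pole_lemma_open f) auto
  show eq: "f z = Moebius_function 0 p z * h z" if "norm z < 1" for z
    using one_minus_cnj_mult_nonzero[OF p(1) that] p(2)
    by (auto simp: h_def Moebius_function_simple)
  have le': "norm (h z) \<le> M" if "norm z < 1" "z \<noteq> p" for z
  proof -
    have "Moebius_function 0 p z \<noteq> 0"
      using one_minus_cnj_mult_nonzero[OF p(1) that(1)] that(2) by (simp add: Moebius_function_simple)
    moreover have "norm (h z) * norm (Moebius_function 0 p z) \<le> M * norm (Moebius_function 0 p z)"
      using Schwarz_Pick_bound[OF f le p that(1)] eq[OF that(1)] by (simp add: norm_mult mult.commute)
    ultimately show ?thesis by simp
  qed
  show "norm (h z) \<le> M" if z: "norm z < 1" for z
  proof (cases "z = p")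
    case True
    have "\<forall>x\<in>ball 0 1. isCont h x"
      using holomorphic_on_imp_continuous_on[OF hol] unfolding continuous_on_eq_continuous_at[OF open_ball] .
    then have "isCont h p" using p(1) by simp
    then have "((\<lambda>z. norm (h z)) \<longlongrightarrow> norm (h p)) (at p)"
      unfolding isCont_def by (rule tendsto_norm)
    moreover have "\<forall>\<^sub>F z in at p. z \<in> ball 0 1 - {p}"
      by (rule eventually_at_in_open) (use p in auto)
    then have "\<forall>\<^sub>F z in at p. norm (h z) \<le> M"
      by (rule eventually_mono) (auto intro: le')
    ultimately show ?thesis unfolding True by (intro tendsto_upperbound) auto
  qed (use le' z in auto)
qed

lemma Blaschke_factor2:
  fixes f :: "complex \<Rightarrow> complex"
  assumes f: "f holomorphic_on ball 0 1" "\<And>z. norm z < 1 \<Longrightarrow> norm (f z) \<le> M"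
    and p: "norm p < 1" "f p = 0" and q: "norm q < 1" "f q = 0" and "p \<noteq> q"
  obtains h where "h holomorphic_on ball 0 1" "\<And>z. norm z < 1 \<Longrightarrow> norm (h z) \<le> M"
    "\<And>z. norm z < 1 \<Longrightarrow> f z = Moebius_function 0 p z * Moebius_function 0 q z * h z"
proof -
  obtain k where k: "k holomorphic_on ball 0 1" "\<And>z. norm z < 1 \<Longrightarrow> norm (k z) \<le> M"
    "\<And>z. norm z < 1 \<Longrightarrow> f z = Moebius_function 0 p z * k z"
    using Blaschke_factor[OF f p] by metis
  have "Moebius_function 0 p q \<noteq> 0"
    using one_minus_cnj_mult_nonzero[OF p(1) q(1)] \<open>p \<noteq> q\<close> by (simp add: Moebius_function_simple)
  then have "k q = 0" using k(3)[OF q(1)] q(2) by simp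
  obtain h where "h holomorphic_on ball 0 1" "\<And>z. norm z < 1 \<Longrightarrow> norm (h z) \<le> M"
    "\<And>z. norm z < 1 \<Longrightarrow> k z = Moebius_function 0 q z * h z"
    using Blaschke_factor[OF k(1,2) q(1) \<open>k q = 0\<close>] by metis
  then show ?thesis using that[of h] k(3) by (simp add: mult.assoc)
qed

text \<open>Here \<open>p\<close>, \<open>q\<close> are exact zeros and \<open>s\<close> an
  approximate one. After division by the Blaschke factors of \<open>p\<close> and \<open>q\<close>
  the quotient is small at \<open>s\<close>, because \<open>s\<close> is away from both; a further
  Schwarz estimate at \<open>s\<close> produces the factor \<open>|s|\<close> up to an
  error.\<close>

lemma three_point_bound:
  fixes f :: "complex \<Rightarrow> complex"
  assumes f: "f holomorphic_on ball 0 1" "\<And>z. norm z < 1 \<Longrightarrow> norm (f z) \<le> M"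
    and p: "norm p < 1" "f p = 0" and q: "norm q < 1" "f q = 0" and "p \<noteq> q"
    and s: "norm s < 1" and c: "0 < c" "c \<le> norm (Moebius_function 0 p s) * norm (Moebius_function 0 q s)"
  shows "norm (f 0) \<le> M * (norm p * norm q * norm s) + 2 * norm (f s) / c"
proof -
  obtain h where h: "h holomorphic_on ball 0 1" "\<And>z. norm z < 1 \<Longrightarrow> norm (h z) \<le> M"
    "\<And>z. norm z < 1 \<Longrightarrow> f z = Moebius_function 0 p z * Moebius_function 0 q z * h z"
    using Blaschke_factor2[OF f p q \<open>p \<noteq> q\<close>] by metis
  have hs: "norm (h s) \<le> norm (f s) / c"
  proof -
    have "c * norm (h s) \<le> norm (Moebius_function 0 p s) * norm (Moebius_function 0 q s) * norm (h s)"
      using c by (intro mult_right_mono) auto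
    also have "\<dots> = norm (f s)" using h(3)[OF s] by (simp add: norm_mult)
    finally show ?thesis using c by (simp add: field_simps)
  qed
  have "norm (h 0 - h s) \<le> (M + norm (h s)) * norm (Moebius_function 0 s 0)"
  proof (rule Schwarz_Pick_bound[where f = "\<lambda>z. h z - h s"])
    show "(\<lambda>z. h z - h s) holomorphic_on ball 0 1" by (intro holomorphic_intros h)
    show "norm (h z - h s) \<le> M + norm (h s)" if "norm z < 1" for z
      using norm_triangle_ineq4[of "h z" "h s"] h(2)[OF that] by simp
  qed (use s in auto)
  then have "norm (h 0) - norm (h s) \<le> (M + norm (h s)) * norm s"
    using norm_triangle_ineq2[of "h 0" "h s"] by (simp add: Moebius_function_of_zero)
  moreover have "norm (h s) * norm s \<le> norm (h s)" using s by (intro mult_left_le) auto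
  ultimately have "norm (h 0) \<le> M * norm s + 2 * norm (h s)" by (simp add: algebra_simps)
  with hs have h0: "norm (h 0) \<le> M * norm s + 2 * norm (f s) / c" by simp
  have pq: "norm p * norm q \<le> 1" using p q by (simp add: mult_le_one)
  have "norm (f 0) = norm p * norm q * norm (h 0)"
    using h(3)[of 0] by (simp add: Moebius_function_of_zero norm_mult)
  also have "\<dots> \<le> norm p * norm q * (M * norm s + 2 * norm (f s) / c)"
    by (intro mult_left_mono h0) auto
  also have "\<dots> = M * (norm p * norm q * norm s) + norm p * norm q * (2 * norm (f s) / c)"
    by (simp add: algebra_simps)
  also have "norm p * norm q * (2 * norm (f s) / c) \<le> 1 * (2 * norm (f s) / c)"
    using pq c by (intro mult_right_mono) auto
  finally show ?thesis by simp
qed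

lemma Schwarz_Pick:
  assumes f: "f holomorphic_on ball 0 1" "\<And>z. norm z < 1 \<Longrightarrow> norm (f z) < 1"
    and z: "norm z < 1" "norm w < 1"
  shows "norm (Moebius_function 0 (f z) (f w)) \<le> norm (Moebius_function 0 z w)"
proof -
  have "norm (Moebius_function 0 (f z) (f w)) \<le> 1 * norm (Moebius_function 0 z w)"
    by (rule Schwarz_Pick_bound[OF Moebius_holomorphic_compose[OF f f(2)[OF z(1)]]])
      (use z f(2) in \<open>auto intro!: less_imp_le Moebius_function_norm_lt_1 simp: Moebius_function_eq_zero\<close>)
  then show ?thesis by simp
qed

text \<open>Schwarz-Pick from the origin, rewritten with \<open>Moebius_pythagoras\<close>: a
  function of sup norm at most 1 that is nearly unimodular at 0 is nearly constant on compact sets.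
  Scaling by \<open>t < 1\<close> supplies the strict bound, and \<open>t\<close> tends to
  1.\<close>

lemma near_constant:
  assumes h: "h holomorphic_on ball 0 1" "\<And>z. norm z < 1 \<Longrightarrow> norm (h z) \<le> 1" and z: "norm z < 1"
  shows "(1 - (norm z)\<^sup>2) * (norm (h z - h 0))\<^sup>2 \<le> 1 - (norm (h 0))\<^sup>2"
proof -
  have "(1 - (norm z)\<^sup>2) * (t * norm (h z - h 0))\<^sup>2 \<le> 1 - (t * norm (h 0))\<^sup>2" if t: "0 < t" "t < 1" for t
  proof -
    define f where "f z = of_real t * h z" for z
    have nf: "norm (f w) = t * norm (h w)" for w using t by (simp add: f_def norm_mult)
    have lt: "norm (f w) < 1" if "norm w < 1" for w
      unfolding nf using h(2)[OF that] t mult_left_le[of "norm (h w)" t] by linarith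
    define A where "A = norm (f z - f 0)"
    define D where "D = norm (1 - cnj (f 0) * f z)"
    have "D > 0" unfolding D_def using one_minus_cnj_mult_nonzero[OF lt lt, of 0 z] z by simp
    have "norm (Moebius_function 0 (f 0) (f z)) \<le> norm (Moebius_function 0 0 z)"
      by (rule Schwarz_Pick) (use lt z in \<open>auto simp: f_def intro!: holomorphic_intros h\<close>)
    then have "A \<le> norm z * D"
      using \<open>D > 0\<close> by (simp add: norm_Moebius_function A_def D_def field_simps)
    then have "A\<^sup>2 \<le> (norm z * D)\<^sup>2" by (rule power_mono) (simp add: A_def)
    also have "\<dots> = (norm z)\<^sup>2 * (A\<^sup>2 + (1 - (norm (f 0))\<^sup>2) * (1 - (norm (f z))\<^sup>2))"
      using Moebius_pythagoras[of "f 0" "f z"] by (simp add: A_def D_def power_mult_distrib)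
    finally have "(1 - (norm z)\<^sup>2) * A\<^sup>2 \<le> (norm z)\<^sup>2 * ((1 - (norm (f 0))\<^sup>2) * (1 - (norm (f z))\<^sup>2))"
      by (simp add: algebra_simps)
    also have "\<dots> \<le> 1 * ((1 - (norm (f 0))\<^sup>2) * (1 - (norm (f z))\<^sup>2))"
      using z lt[OF z] lt[of 0] by (intro mult_right_mono mult_nonneg_nonneg) (auto simp: power_le_one)
    also have "\<dots> \<le> (1 - (norm (f 0))\<^sup>2) * 1"
      using lt[of 0] unfolding mult_1 by (intro mult_left_mono) (auto simp: power_le_one)
    finally have "(1 - (norm z)\<^sup>2) * A\<^sup>2 \<le> 1 - (norm (f 0))\<^sup>2" by simp
    moreover have "A = t * norm (h z - h 0)"
      using t by (simp add: A_def f_def norm_mult flip: right_diff_distrib)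
    ultimately show ?thesis by (simp add: nf)
  qed
  then have "\<forall>\<^sub>F t in at_left 1. (1 - (norm z)\<^sup>2) * (t * norm (h z - h 0))\<^sup>2 \<le> 1 - (t * norm (h 0))\<^sup>2"
    by (intro eventually_mono[OF eventually_at_left_real[of 0 1]]) auto
  moreover have "((\<lambda>t. (1 - (norm z)\<^sup>2) * (t * norm (h z - h 0))\<^sup>2) \<longlongrightarrow> (1 - (norm z)\<^sup>2) * (1 * norm (h z - h 0))\<^sup>2) (at_left 1)"
    by (intro tendsto_intros)
  moreover have "((\<lambda>t. 1 - (t * norm (h 0))\<^sup>2) \<longlongrightarrow> 1 - (1 * norm (h 0))\<^sup>2) (at_left 1)"
    by (intro tendsto_intros)
  ultimately have "(1 - (norm z)\<^sup>2) * (1 * norm (h z - h 0))\<^sup>2 \<le> 1 - (1 * norm (h 0))\<^sup>2"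
    by (intro tendsto_le[OF trivial_limit_at_left_real])
  then show ?thesis by simp
qed

lemma norm_diff_le_Moebius:
  assumes "norm u < 1" "norm z < 1"
  shows "norm (z - u) \<le> 2 * norm (Moebius_function 0 u z)"
proof -
  have "norm (cnj u * z) \<le> 1" using assms by (simp add: norm_mult mult_le_one)
  then have "norm (1 - cnj u * z) \<le> 2"
    using norm_triangle_ineq4[of 1 "cnj u * z"] by simp
  then have "norm (z - u) * norm (1 - cnj u * z) \<le> norm (z - u) * 2" by (intro mult_left_mono) auto
  moreover have "0 < norm (1 - cnj u * z)" using one_minus_cnj_mult_nonzero[OF assms] by simp
  ultimately show ?thesis by (simp add: norm_Moebius_function field_simps)
qed

lemma norm_Moebius_commute: "norm (Moebius_function 0 u v) = norm (Moebius_function 0 v u)"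
proof -
  have "norm (1 - cnj u * v) = norm (cnj (1 - cnj u * v))" by (simp only: complex_mod_cnj)
  also have "cnj (1 - cnj u * v) = 1 - cnj v * u" by simp
  finally show ?thesis by (simp add: norm_Moebius_function norm_minus_commute)
qed

text \<open>Over the common denominator the numerator is at most \<open>4 |u - v|\<close>, and each
  denominator is at least \<open>E / 2\<close>; this explains the 16.\<close>

lemma Moebius_diff_le:
  assumes E: "0 < E" "E \<le> 1 - (norm u)\<^sup>2" "E \<le> 1 - (norm v)\<^sup>2" and z: "norm z < 1"
  shows "norm (Moebius_function 0 u z - Moebius_function 0 v z) \<le> 16 * norm (u - v) / E\<^sup>2"
proof -
  have uv: "norm u < 1" "norm v < 1" using E power_less_one_iff[of "norm u" 2] power_less_one_iff[of "norm v" 2] by auto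
  have D: "E / 2 \<le> norm (1 - cnj w * z)" if "E \<le> 1 - (norm w)\<^sup>2" "norm w < 1" for w
  proof -
    have "1 - (norm w)\<^sup>2 = (1 - norm w) * (1 + norm w)" by (simp add: power2_eq_square algebra_simps)
    also have "\<dots> \<le> (1 - norm w) * 2" using that by (intro mult_left_mono) auto
    finally show ?thesis using that norm_one_minus_cnj_mult_ge[of z w] z by simp
  qed
  have nz: "1 - cnj u * z \<noteq> 0" "1 - cnj v * z \<noteq> 0"
    using one_minus_cnj_mult_nonzero uv z by auto
  have "Moebius_function 0 u z - Moebius_function 0 v z =
      ((z - u) * (1 - cnj v * z) - (z - v) * (1 - cnj u * z)) / ((1 - cnj u * z) * (1 - cnj v * z))"
    using nz by (simp add: Moebius_function_simple diff_frac_eq mult.commute)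
  also have "(z - u) * (1 - cnj v * z) - (z - v) * (1 - cnj u * z) =
      - (u - v) + z * z * cnj (u - v) + (cnj u * (u - v) - u * cnj (u - v)) * z"
    by (simp add: algebra_simps)
  finally have eq: "Moebius_function 0 u z - Moebius_function 0 v z =
      (- (u - v) + z * z * cnj (u - v) + (cnj u * (u - v) - u * cnj (u - v)) * z) / ((1 - cnj u * z) * (1 - cnj v * z))" .
  define d where "d = norm (u - v)"
  have "norm (- (u - v) + z * z * cnj (u - v) + (cnj u * (u - v) - u * cnj (u - v)) * z) \<le>
     d + norm (z * z * cnj (u - v)) + norm ((cnj u * (u - v) - u * cnj (u - v)) * z)"
  proof -
    have "norm (A + B + C) \<le> norm A + norm B + norm C" for A B C :: complex
      using norm_triangle_ineq[of "A + B" C] norm_triangle_ineq[of A B] by linarith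
    then show ?thesis unfolding d_def by (metis norm_minus_cancel)
  qed
  also have "norm (z * z * cnj (u - v)) \<le> 1 * d"
    unfolding norm_mult complex_mod_cnj d_def using z by (intro mult_right_mono) (auto simp: mult_le_one)
  also have "norm ((cnj u * (u - v) - u * cnj (u - v)) * z) \<le> (2 * d) * 1"
    unfolding norm_mult
  proof (intro mult_mono)
    have "norm u * d \<le> 1 * d" using uv by (intro mult_right_mono) (auto simp: d_def)
    then show "norm (cnj u * (u - v) - u * cnj (u - v)) \<le> 2 * d"
      using norm_triangle_ineq4[of "cnj u * (u - v)" "u * cnj (u - v)"]
      unfolding norm_mult complex_mod_cnj d_def by simp
  qed (use z in \<open>auto simp: d_def\<close>)
  finally have num: "norm (- (u - v) + z * z * cnj (u - v) + (cnj u * (u - v) - u * cnj (u - v)) * z) \<le> 4 * d" by simp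
  have den: "E / 2 * (E / 2) \<le> norm ((1 - cnj u * z) * (1 - cnj v * z))"
    unfolding norm_mult using E D uv by (intro mult_mono) auto
  have "norm (Moebius_function 0 u z - Moebius_function 0 v z) \<le> 4 * d / (E / 2 * (E / 2))"
    unfolding eq norm_divide using num den E by (intro frac_le) (auto simp: d_def)
  then show ?thesis by (simp add: d_def power2_eq_square field_simps)
qed

section \<open>Lower bound for the Lempert function\<close>

text \<open>The right-hand side equals \<open>2 |w| / (1 + |w|^2)\<close>.\<close>

lemma norm_Moebius_antipodal_ge: "norm w \<le> 1 \<Longrightarrow> norm w \<le> norm (Moebius_function 0 w (- w))"
proof -
  assume w: "norm w \<le> 1"
  have "1 - cnj w * (- w) = of_real (1 + (norm w)\<^sup>2)"
    using complex_norm_square[of w] by (simp add: mult.commute)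
  then have "norm (1 - cnj w * (- w)) = 1 + (norm w)\<^sup>2"
    by (simp only: norm_of_real) simp
  moreover have "norm (- w - w) = 2 * norm w"
    using norm_mult[of 2 w] by (simp flip: norm_minus_cancel[of "- w - w"])
  moreover have "norm w * (1 + (norm w)\<^sup>2) \<le> norm w * 2"
    using w by (intro mult_left_mono) (auto simp: power_le_one)
  ultimately show ?thesis
    by (simp add: norm_Moebius_function pos_le_divide_eq add_pos_nonneg)
qed

text \<open>At the origin the Moebius image of \<open>f\<close> has modulus \<open>|w|\<close>, so
  \<open>|h 0|\<close> measures how far the product of the two preimages is from its least possible
  value \<open>|w|\<close>.\<close>

lemma Blaschke_pair_factor:
  fixes f :: "complex \<Rightarrow> complex"
  assumes f: "f holomorphic_on ball 0 1" "\<And>z. norm z < 1 \<Longrightarrow> norm (f z) < 1" "f 0 = 0"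
    and pq: "norm p < 1" "norm q < 1" "p \<noteq> q" "f p = w" "f q = w"
  obtains h where "h holomorphic_on ball 0 1" "\<And>z. norm z < 1 \<Longrightarrow> norm (h z) \<le> 1"
    "\<And>z. norm z < 1 \<Longrightarrow> Moebius_function 0 w (f z) = Moebius_function 0 p z * Moebius_function 0 q z * h z"
    "norm w = norm (p * q) * norm (h 0)" "norm w \<le> norm (p * q)"
proof -
  have w: "norm w < 1" using f(2)[OF pq(1)] pq(4) by simp
  obtain h where h: "h holomorphic_on ball 0 1" "\<And>z. norm z < 1 \<Longrightarrow> norm (h z) \<le> 1"
    "\<And>z. norm z < 1 \<Longrightarrow> Moebius_function 0 w (f z) = Moebius_function 0 p z * Moebius_function 0 q z * h z"
    using Blaschke_factor2[OF Moebius_holomorphic_compose[OF f(1,2) w], of 1 p q] pq f(2) w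
      less_imp_le[OF Moebius_function_norm_lt_1[OF w]] by (metis Moebius_function_eq_zero)
  have eq: "norm w = norm (p * q) * norm (h 0)"
    using arg_cong[OF h(3)[of 0], of norm] f(3) by (simp add: Moebius_function_of_zero norm_mult)
  also have "\<dots> \<le> norm (p * q)" using h(2)[of 0] by (intro mult_left_le) auto
  finally show ?thesis using that h eq by blast
qed

text \<open>Keeps a close pair with almost minimal product inside a fixed compact disc.\<close>

lemma norm_sq_le_of_close:
  assumes "norm p < 1" "norm q < 1" "norm (Moebius_function 0 p q) \<le> t"
  shows "(norm (p::complex))\<^sup>2 \<le> norm (p * q) + 2 * t"
proof -
  have "norm (q - p) \<le> 2 * t" using norm_diff_le_Moebius[OF assms(1,2)] assms(3) by simp
  then have "norm p \<le> norm q + 2 * t" using norm_triangle_ineq2[of p q] by (simp add: norm_minus_commute)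
  then have "norm p * norm p \<le> norm p * (norm q + 2 * t)" by (intro mult_left_mono) auto
  also have "\<dots> \<le> norm p * norm q + 2 * t"
  proof -
    have "0 \<le> t" using assms(3) norm_ge_zero order_trans by blast
    then have "norm p * (2 * t) \<le> 2 * t" using assms(1) by (intro mult_left_le_one_le) auto
    then show ?thesis by (simp add: algebra_simps)
  qed
  finally show ?thesis by (simp add: power2_eq_square norm_mult)
qed

section \<open>Close pairs over both \<open>a\<close> and \<open>-a\<close> are impossible\<close>

text \<open>The main inequality opposes an upper and a lower bound of one number in
  \<open>not_both_fibres_degenerate\<close>. At \<open>t = 0\<close> it reads
  \<open>0 < \<alpha>^2\<close>, so it persists for small \<open>t\<close>.\<close>

lemma separation_parameter:
  fixes \<alpha> :: real
  assumes \<alpha>: "0 < \<alpha>" "\<alpha> < 1"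
  defines "E \<equiv> (1 - \<alpha>) / 2"
  obtains t :: real where "0 < t" "3 * t \<le> E"
    "4 * (64 * t / E\<^sup>2 + 2 * sqrt (2 * t / (E ^ 3 / 16))) / ((1 - \<alpha>\<^sup>2) * (1 - \<alpha>))
       < \<alpha> * (\<alpha> - 32 * t / E\<^sup>2) * (1 / (1 + t) - sqrt (2 * t / (E ^ 3 / 16)))"
    "0 \<le> \<alpha> - 32 * t / E\<^sup>2" "0 \<le> 1 / (1 + t) - sqrt (2 * t / (E ^ 3 / 16))"
proof -
  have E: "E > 0" using \<alpha> by (simp add: E_def)
  have a2: "(1 - \<alpha>\<^sup>2) * (1 - \<alpha>) \<noteq> 0" using \<alpha> power_less_one_iff[of \<alpha> 2] by auto
  define L where "L t = 4 * (64 * t / E\<^sup>2 + 2 * sqrt (2 * t / (E ^ 3 / 16))) / ((1 - \<alpha>\<^sup>2) * (1 - \<alpha>))" for t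
  define A where "A t = \<alpha> - 32 * t / E\<^sup>2" for t
  define B where "B t = 1 / (1 + t) - sqrt (2 * t / (E ^ 3 / 16))" for t
  have "((\<lambda>t. \<alpha> * A t * B t - L t) \<longlongrightarrow> \<alpha> * A 0 * B 0 - L 0) (at_right 0)"
    unfolding A_def B_def L_def using E a2 by (intro tendsto_intros) auto
  then have 1: "\<forall>\<^sub>F t in at_right 0. 0 < \<alpha> * A t * B t - L t"
    by (rule order_tendstoD(1)) (use \<alpha> in \<open>simp add: A_def B_def L_def\<close>)
  have "(A \<longlongrightarrow> A 0) (at_right 0)" "(B \<longlongrightarrow> B 0) (at_right 0)"
    unfolding A_def B_def using E by (intro tendsto_intros; simp)+
  moreover have "0 < A 0" "0 < B 0" using \<alpha> by (simp_all add: A_def B_def)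
  ultimately have 2: "\<forall>\<^sub>F t in at_right 0. 0 < A t" "\<forall>\<^sub>F t in at_right 0. 0 < B t"
    by (blast intro: order_tendstoD(1))+
  have 3: "\<forall>\<^sub>F t in at_right 0. t \<in> {0<..<E/3}" using E by (intro eventually_at_right_real) simp
  from eventually_happens'[OF _ eventually_conj[OF 1 eventually_conj[OF 2(1) eventually_conj[OF 2(2) 3]]]]
  obtain t where "0 < \<alpha> * A t * B t - L t" "0 < A t" "0 < B t" "0 < t" "3 * t < E" by auto
  then show ?thesis using that[of t] unfolding A_def B_def L_def by simp
qed

text \<open>A quantitative form of the single critical point. If \<open>\<zeta>2\<close>,
  \<open>\<zeta>3\<close> nearly coincide, \<open>f\<close> is nearly even about
  \<open>\<zeta>2\<close>, so it nearly takes the value \<open>a\<close> at the mirror image of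
  \<open>\<zeta>1\<close>. But the near-extremal factorisation over \<open>a\<close> allows this
  only near \<open>\<zeta>1\<close> or \<open>\<zeta>4\<close>, which are themselves close together
  and far from that image.\<close>

lemma not_both_fibres_degenerate:
  fixes a :: complex
  assumes a: "0 < norm a" "norm a < 1"
  obtains t where "0 < t"
    "\<And>f \<zeta>1 \<zeta>2 \<zeta>3 \<zeta>4. \<lbrakk>f holomorphic_on ball 0 1; \<And>z. norm z < 1 \<Longrightarrow> norm (f z) < 1; f 0 = 0;
       norm \<zeta>1 < 1; norm \<zeta>2 < 1; norm \<zeta>3 < 1; norm \<zeta>4 < 1;
       f \<zeta>1 = a; f \<zeta>4 = a; f \<zeta>2 = - a; f \<zeta>3 = - a; \<zeta>1 \<noteq> \<zeta>4; \<zeta>2 \<noteq> \<zeta>3;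
       norm (\<zeta>1 * \<zeta>4) \<le> norm a * (1 + t); norm (\<zeta>2 * \<zeta>3) \<le> norm a * (1 + t);
       norm (Moebius_function 0 \<zeta>1 \<zeta>4) \<le> t; norm (Moebius_function 0 \<zeta>2 \<zeta>3) \<le> t\<rbrakk> \<Longrightarrow> False"
proof -
  define \<alpha> where "\<alpha> = norm a"
  \<comment> \<open>Points of a close pair satisfy \<open>|p|^2 \<le> \<alpha> + 3 t\<close>; with
    \<open>3 t \<le> E\<close> this leaves \<open>1 - |p|^2 \<ge> E\<close>.\<close>
  define E where "E = (1 - \<alpha>) / 2"
  \<comment> \<open>Each Moebius map in the construction of \<open>\<xi>\<close> costs a factor
    \<open>E / 4\<close>, and two of them are used: \<open>E (E E / 4) / 4\<close>.\<close>
  define E' where "E' = E ^ 3 / 16"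
  have \<alpha>: "0 < \<alpha>" "\<alpha> < 1" using a by (auto simp: \<alpha>_def)
  have E: "0 < E" "E < 1" using \<alpha> by (auto simp: E_def)
  have E': "0 < E'" "E' \<le> E" using E power_decreasing[of 1 3 E] by (auto simp: E'_def)
  obtain t where t: "0 < t" "3 * t \<le> E"
    and gap: "4 * (64 * t / E\<^sup>2 + 2 * sqrt (2 * t / E')) / ((1 - \<alpha>\<^sup>2) * (1 - \<alpha>))
       < \<alpha> * (\<alpha> - 32 * t / E\<^sup>2) * (1 / (1 + t) - sqrt (2 * t / E'))"
    and pos: "0 \<le> \<alpha> - 32 * t / E\<^sup>2" "0 \<le> 1 / (1 + t) - sqrt (2 * t / E')"
    using separation_parameter[OF \<alpha>] unfolding E_def E'_def by metis
  show ?thesis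
  proof (rule that[OF t(1)])
    fix f :: "complex \<Rightarrow> complex" and \<zeta>1 \<zeta>2 \<zeta>3 \<zeta>4
    assume f: "f holomorphic_on ball 0 1" "\<And>z. norm z < 1 \<Longrightarrow> norm (f z) < 1" "f 0 = 0"
      and \<zeta>: "norm \<zeta>1 < 1" "norm \<zeta>2 < 1" "norm \<zeta>3 < 1" "norm \<zeta>4 < 1"
      and v: "f \<zeta>1 = a" "f \<zeta>4 = a" "f \<zeta>2 = - a" "f \<zeta>3 = - a" and ne: "\<zeta>1 \<noteq> \<zeta>4" "\<zeta>2 \<noteq> \<zeta>3"
      and small: "norm (\<zeta>1 * \<zeta>4) \<le> norm a * (1 + t)" "norm (\<zeta>2 * \<zeta>3) \<le> norm a * (1 + t)"
      and close: "norm (Moebius_function 0 \<zeta>1 \<zeta>4) \<le> t" "norm (Moebius_function 0 \<zeta>2 \<zeta>3) \<le> t"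
    have sq: "E \<le> 1 - (norm p)\<^sup>2"
      if "norm p < 1" "norm q < 1" "norm (Moebius_function 0 p q) \<le> t" "norm (p * q) \<le> norm a * (1 + t)" for p q
    proof -
      have "norm a * t \<le> t" using a t by (intro mult_left_le_one_le) auto
      then have "(norm p)\<^sup>2 \<le> \<alpha> + 3 * t"
        using norm_sq_le_of_close[OF that(1-3)] that(4) by (simp add: \<alpha>_def algebra_simps)
      then show ?thesis using t(2) by (simp add: E_def)
    qed
    have E1: "E \<le> 1 - (norm \<zeta>1)\<^sup>2" by (rule sq[OF \<zeta>(1,4) close(1) small(1)])
    have E2: "E \<le> 1 - (norm \<zeta>2)\<^sup>2" by (rule sq[OF \<zeta>(2,3) close(2) small(2)])
    have E3: "E \<le> 1 - (norm \<zeta>3)\<^sup>2"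
      by (rule sq[OF \<zeta>(3,2)]) (use close(2) small(2) in \<open>simp_all add: norm_Moebius_commute mult.commute\<close>)
    have E4: "E \<le> 1 - (norm \<zeta>4)\<^sup>2"
      by (rule sq[OF \<zeta>(4,1)]) (use close(1) small(1) in \<open>simp_all add: norm_Moebius_commute mult.commute\<close>)
    obtain h where h: "h holomorphic_on ball 0 1" "\<And>z. norm z < 1 \<Longrightarrow> norm (h z) \<le> 1"
      "\<And>z. norm z < 1 \<Longrightarrow> Moebius_function 0 (- a) (f z) = Moebius_function 0 \<zeta>2 z * Moebius_function 0 \<zeta>3 z * h z"
      "norm (- a) = norm (\<zeta>2 * \<zeta>3) * norm (h 0)"
      using Blaschke_pair_factor[OF f \<zeta>(2,3) ne(2) v(3,4)] by metis
    obtain g where g: "g holomorphic_on ball 0 1" "\<And>z. norm z < 1 \<Longrightarrow> norm (g z) \<le> 1"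
      "\<And>z. norm z < 1 \<Longrightarrow> Moebius_function 0 a (f z) = Moebius_function 0 \<zeta>1 z * Moebius_function 0 \<zeta>4 z * g z"
      "norm a = norm (\<zeta>1 * \<zeta>4) * norm (g 0)"
      using Blaschke_pair_factor[OF f \<zeta>(1,4) ne(1) v(1,2)] by metis
    have near1: "1 / (1 + t) \<le> y" if "norm a = x * y" "x \<le> norm a * (1 + t)" "0 \<le> y" for x y
    proof -
      have "norm a \<le> norm a * (1 + t) * y" unfolding that(1)[symmetric] using mult_right_mono[OF that(2,3)] that(1) by simp
      then have "norm a * 1 \<le> norm a * ((1 + t) * y)" by simp
      then have "1 \<le> (1 + t) * y" using a(1) mult_le_cancel_left_pos by blast
      then show ?thesis using t by (simp add: field_simps)
    qed
    have h0: "1 / (1 + t) \<le> norm (h 0)" using near1[OF _ small(2)] h(4) by simp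
    have g0: "1 / (1 + t) \<le> norm (g 0)" using near1[OF _ small(1)] g(4) by simp
    \<comment> \<open>From \<open>1 / (1 + t) \<le> |k 0|\<close> follows
      \<open>1 - |k 0|^2 \<le> 2 t\<close>, and \<open>near_constant\<close> bounds the oscillation
      of \<open>k\<close>.\<close>
    have osc: "norm (k z - k 0) \<le> sqrt (2 * t / E')"
      if k: "k holomorphic_on ball 0 1" "\<And>z. norm z < 1 \<Longrightarrow> norm (k z) \<le> 1" "1 / (1 + t) \<le> norm (k 0)"
        and z: "norm z < 1" "E' \<le> 1 - (norm z)\<^sup>2" for k z
    proof -
      have "1 - 2 * t \<le> (1 / (1 + t))\<^sup>2"
      proof -
        have "1 - t \<le> 1 / (1 + t)" using t by (simp add: field_simps power2_eq_square)
        moreover have "1 - 2 * t \<le> (1 - t)\<^sup>2" by (simp add: power2_eq_square algebra_simps)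
        moreover have "0 \<le> 1 - t" using t E by simp
        ultimately show ?thesis using power_mono[of "1 - t" "1 / (1 + t)" 2] by linarith
      qed
      also have "\<dots> \<le> (norm (k 0))\<^sup>2" using k(3) t by (intro power_mono) auto
      finally have "1 - (norm (k 0))\<^sup>2 \<le> 2 * t" by simp
      moreover have "E' * (norm (k z - k 0))\<^sup>2 \<le> (1 - (norm z)\<^sup>2) * (norm (k z - k 0))\<^sup>2"
        using z(2) by (intro mult_right_mono) auto
      ultimately have "E' * (norm (k z - k 0))\<^sup>2 \<le> 2 * t" using near_constant[OF k(1,2) z(1)] by simp
      then have "(norm (k z - k 0))\<^sup>2 \<le> 2 * t / E'" using E' by (simp add: field_simps)
      then show ?thesis by (rule real_le_rsqrt)
    qed
    \<comment> \<open>Centred at \<open>\<zeta>2\<close>, \<open>f\<close> is almost even, so it almost takes the value \<open>a\<close> at the reflection \<open>\<xi>\<close> of \<open>\<zeta>1\<close>,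
      which is far from both \<open>\<zeta>1\<close> and \<open>\<zeta>4\<close>.\<close>
    define p where "p = Moebius_function 0 \<zeta>2 \<zeta>1"
    define \<xi> where "\<xi> = Moebius_function 0 (- \<zeta>2) (- p)"
    have p1: "norm p < 1" unfolding p_def using \<zeta> by (intro Moebius_function_norm_lt_1)
    have \<xi>1: "norm \<xi> < 1" unfolding \<xi>_def using p1 \<zeta> by (intro Moebius_function_norm_lt_1) auto
    have \<beta>\<xi>: "Moebius_function 0 \<zeta>2 \<xi> = - p"
      unfolding \<xi>_def using p1 \<zeta> by (intro Moebius_function_compose) auto
    have M4: "e1 * e2 / 4 \<le> 1 - (norm (Moebius_function 0 w z))\<^sup>2"
      if "norm w < 1" "norm z < 1" "0 \<le> e1" "e1 \<le> 1 - (norm w)\<^sup>2" "0 \<le> e2" "e2 \<le> 1 - (norm z)\<^sup>2" for w z e1 e2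
      unfolding one_minus_Moebius_sq[OF that(1,2)]
    proof (rule frac_le)
      show "e1 * e2 \<le> (1 - (norm w)\<^sup>2) * (1 - (norm z)\<^sup>2)" using that by (intro mult_mono) auto
      then show "0 \<le> (1 - (norm w)\<^sup>2) * (1 - (norm z)\<^sup>2)" using that by (meson mult_nonneg_nonneg order_trans)
      show "0 < (norm (1 - cnj w * z))\<^sup>2" using one_minus_cnj_mult_nonzero[OF that(1,2)] by simp
      have "norm (cnj w * z) \<le> 1" using that by (simp add: norm_mult mult_le_one)
      then have "norm (1 - cnj w * z) \<le> 2" using norm_triangle_ineq4[of 1 "cnj w * z"] by simp
      then show "(norm (1 - cnj w * z))\<^sup>2 \<le> 4" using power_mono[of "norm (1 - cnj w * z)" 2 2] by simp
    qed
    have "E * E / 4 \<le> 1 - (norm p)\<^sup>2" unfolding p_def using \<zeta> E E1 E2 by (intro M4) auto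
    then have "E * (E * E / 4) / 4 \<le> 1 - (norm \<xi>)\<^sup>2"
      unfolding \<xi>_def using \<zeta> E E2 p1 by (intro M4) auto
    then have E\<xi>: "E' \<le> 1 - (norm \<xi>)\<^sup>2" by (simp add: E'_def power3_eq_cube)
    have E'1: "E' \<le> 1 - (norm \<zeta>1)\<^sup>2" using E1 E' by simp
    define \<sigma> where "\<sigma> = sqrt (2 * t / E')"

    \<comment> \<open>Schwarz-Pick applied to \<open>f\<close>, which separates
      \<open>\<zeta>1\<close> from \<open>\<zeta>2\<close> because their values are antipodal. The
      antipodal estimate for \<open>p\<close> then carries the distance over to
      \<open>\<xi>\<close>.\<close>
    have "\<alpha> \<le> norm p"
    proof -
      have "\<alpha> \<le> norm (Moebius_function 0 (- a) (- (- a)))"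
        using norm_Moebius_antipodal_ge[of "- a"] a by (simp add: \<alpha>_def)
      also have "\<dots> = norm (Moebius_function 0 (f \<zeta>2) (f \<zeta>1))" by (simp add: v)
      also have "\<dots> \<le> norm p" unfolding p_def by (rule Schwarz_Pick[OF f(1,2) \<zeta>(2,1)])
      finally show ?thesis .
    qed
    also have "norm p \<le> norm (Moebius_function 0 p (- p))" using p1 by (intro norm_Moebius_antipodal_ge) simp
    also have "\<dots> = norm (Moebius_function 0 (Moebius_function 0 \<zeta>2 \<zeta>1) (Moebius_function 0 \<zeta>2 \<xi>))"
      by (simp add: \<beta>\<xi> p_def)
    also have "\<dots> \<le> norm (Moebius_function 0 \<zeta>1 \<xi>)"
      by (rule Schwarz_Pick[OF Moebius_function_holomorphic Moebius_function_norm_lt_1]) (use \<zeta> \<xi>1 in auto)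
    finally have far1: "\<alpha> \<le> norm (Moebius_function 0 \<zeta>1 \<xi>)" .
    have shift: "norm (Moebius_function 0 u z - Moebius_function 0 w z) \<le> 32 * t / E\<^sup>2"
      if "norm u < 1" "norm w < 1" "E \<le> 1 - (norm u)\<^sup>2" "E \<le> 1 - (norm w)\<^sup>2" "norm (Moebius_function 0 u w) \<le> t"
        "norm z < 1" for u w z
    proof -
      have "norm (u - w) \<le> 2 * t"
        using norm_diff_le_Moebius[OF that(1,2)] that(5) by (simp add: norm_minus_commute)
      then have "16 * norm (u - w) / E\<^sup>2 \<le> 32 * t / E\<^sup>2" by (intro divide_right_mono) auto
      then show ?thesis using Moebius_diff_le[OF E(1) that(3,4,6)] by simp
    qed
    have "norm (Moebius_function 0 \<zeta>1 \<xi> - Moebius_function 0 \<zeta>4 \<xi>) \<le> 32 * t / E\<^sup>2"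
      by (rule shift[OF \<zeta>(1,4) E1 E4 close(1) \<xi>1])
    then have far4: "\<alpha> - 32 * t / E\<^sup>2 \<le> norm (Moebius_function 0 \<zeta>4 \<xi>)"
      using far1 norm_triangle_ineq2[of "Moebius_function 0 \<zeta>1 \<xi>" "Moebius_function 0 \<zeta>4 \<xi>"] by simp
    have "norm (g \<xi> - g 0) \<le> \<sigma>" unfolding \<sigma>_def by (rule osc[OF g(1,2) g0 \<xi>1 E\<xi>])
    then have "1 / (1 + t) - \<sigma> \<le> norm (g \<xi>)"
      using g0 norm_triangle_ineq2[of "g 0" "g \<xi>"] by (simp add: norm_minus_commute)
    then have "\<alpha> * (\<alpha> - 32 * t / E\<^sup>2) * (1 / (1 + t) - \<sigma>) \<le> norm (Moebius_function 0 a (f \<xi>))"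
      unfolding g(3)[OF \<xi>1] norm_mult using far1 far4 pos \<alpha> unfolding \<sigma>_def by (intro mult_mono mult_nonneg_nonneg) auto
    moreover
    define k where "k z = Moebius_function 0 (- a) (f z)" for z
    \<comment> \<open>The factor of \<open>\<zeta>2\<close> takes opposite values \<open>p\<close>,
      \<open>- p\<close> at \<open>\<zeta>1\<close> and \<open>\<xi>\<close>; that of
      \<open>\<zeta>3\<close> nearly does, so \<open>A + B\<close> is small. As \<open>h\<close> is
      nearly constant, the two values of \<open>k\<close> almost agree.\<close>
    have kdiff: "norm (k \<zeta>1 - k \<xi>) \<le> 64 * t / E\<^sup>2 + 2 * \<sigma>"
    proof -
      define A where "A = Moebius_function 0 \<zeta>3 \<zeta>1"
      define B where "B = Moebius_function 0 \<zeta>3 \<xi>"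
      have AB: "norm A \<le> 1" "norm B \<le> 1"
        unfolding A_def B_def using \<zeta> \<xi>1 by (auto intro!: less_imp_le Moebius_function_norm_lt_1)
      have "k \<zeta>1 - k \<xi> = p * ((A + B) * h \<zeta>1 + B * ((h \<xi> - h 0) - (h \<zeta>1 - h 0)))"
        unfolding k_def h(3)[OF \<zeta>(1)] h(3)[OF \<xi>1] \<beta>\<xi> A_def[symmetric] B_def[symmetric] p_def[symmetric]
        by (simp add: algebra_simps)
      also have "norm \<dots> \<le> norm ((A + B) * h \<zeta>1 + B * ((h \<xi> - h 0) - (h \<zeta>1 - h 0)))"
        unfolding norm_mult using p1 by (intro mult_left_le_one_le) auto
      also have "\<dots> \<le> norm (A + B) * norm (h \<zeta>1) + norm B * norm ((h \<xi> - h 0) - (h \<zeta>1 - h 0))"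
        by (metis norm_mult norm_triangle_ineq)
      also have "norm (A + B) * norm (h \<zeta>1) \<le> norm (A + B)"
        using h(2)[OF \<zeta>(1)] by (intro mult_left_le) auto
      also have "norm B * norm ((h \<xi> - h 0) - (h \<zeta>1 - h 0)) \<le> norm ((h \<xi> - h 0) - (h \<zeta>1 - h 0))"
        using AB by (intro mult_left_le_one_le) auto
      also have "\<dots> \<le> norm (h \<xi> - h 0) + norm (h \<zeta>1 - h 0)" by (rule norm_triangle_ineq4)
      also have "norm (h \<xi> - h 0) \<le> \<sigma>" unfolding \<sigma>_def by (rule osc[OF h(1,2) h0 \<xi>1 E\<xi>])
      also have "norm (h \<zeta>1 - h 0) \<le> \<sigma>" unfolding \<sigma>_def by (rule osc[OF h(1,2) h0 \<zeta>(1) E'1])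
      also have "norm (A + B) \<le> 32 * t / E\<^sup>2 + 32 * t / E\<^sup>2"
      proof -
        have "A + B = - (p - A) - (- p - B)" by simp
        also have "norm \<dots> \<le> norm (p - A) + norm (- p - B)"
          using norm_triangle_ineq4[of "- (p - A)" "- p - B"] by (simp only: norm_minus_cancel)
        also have "norm (p - A) \<le> 32 * t / E\<^sup>2"
          unfolding A_def p_def by (rule shift[OF \<zeta>(2,3) E2 E3 close(2) \<zeta>(1)])
        also have "norm (- p - B) \<le> 32 * t / E\<^sup>2"
          unfolding B_def \<beta>\<xi>[symmetric] by (rule shift[OF \<zeta>(2,3) E2 E3 close(2) \<xi>1])
        finally show ?thesis by simp
      qed
      finally show ?thesis by simp
    qed
    \<comment> \<open>Since \<open>f \<zeta>1 = a\<close>, the difference of the two values of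
      \<open>k\<close> is \<open>a - f \<xi>\<close> times a factor bounded away from 0, so
      closeness of the values of \<open>k\<close> forces \<open>f \<xi>\<close> close to
      \<open>a\<close>.\<close>
    have "norm (Moebius_function 0 a (f \<xi>)) \<le> 4 * norm (k \<zeta>1 - k \<xi>) / ((1 - \<alpha>\<^sup>2) * (1 - \<alpha>))"
    proof -
      define w where "w = f \<xi>"
      have w: "norm w < 1" unfolding w_def by (rule f(2)[OF \<xi>1])
      have nz: "1 + cnj a * w \<noteq> 0" "1 + cnj a * a \<noteq> 0"
        using one_minus_cnj_mult_nonzero[of "- a" w] one_minus_cnj_mult_nonzero[of "- a" a] a w by auto
      have "k \<zeta>1 - k \<xi> = (a + a) / (1 + cnj a * a) - (w + a) / (1 + cnj a * w)"
        by (simp add: k_def v Moebius_function_simple w_def)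
      also have "\<dots> = ((a + a) * (1 + cnj a * w) - (w + a) * (1 + cnj a * a)) / ((1 + cnj a * a) * (1 + cnj a * w))"
        using nz by (simp add: diff_frac_eq)
      also have "(a + a) * (1 + cnj a * w) - (w + a) * (1 + cnj a * a) = (a - w) * (1 - cnj a * a)"
        by (simp add: algebra_simps)
      finally have keq: "k \<zeta>1 - k \<xi> = (a - w) * (1 - cnj a * a) / ((1 + cnj a * a) * (1 + cnj a * w))" .
      have le2: "norm (1 + cnj a * z) \<le> 2" if "norm z < 1" for z
      proof -
        have "norm (cnj a * z) \<le> 1" using that a by (simp add: norm_mult mult_le_one)
        then show ?thesis using norm_triangle_ineq[of 1 "cnj a * z"] by simp
      qed
      have "1 - cnj a * a = of_real (1 - \<alpha>\<^sup>2)"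
        using complex_norm_square[of a] by (simp add: \<alpha>_def mult.commute)
      then have na: "norm (1 - cnj a * a) = 1 - \<alpha>\<^sup>2"
        using \<alpha> by (simp only: norm_of_real) (simp add: power_le_one)
      have "norm (a - w) * (1 - \<alpha>\<^sup>2) = norm (k \<zeta>1 - k \<xi>) * (norm (1 + cnj a * a) * norm (1 + cnj a * w))"
        unfolding keq norm_divide norm_mult na using nz by simp
      also have "\<dots> \<le> norm (k \<zeta>1 - k \<xi>) * (2 * 2)"
        using le2[of a] le2[of w] a w by (intro mult_left_mono mult_mono) auto
      finally have 1: "norm (w - a) * (1 - \<alpha>\<^sup>2) \<le> 4 * norm (k \<zeta>1 - k \<xi>)"
        by (simp add: norm_minus_commute)
      have a2: "0 < 1 - \<alpha>\<^sup>2" using \<alpha> by (simp add: power_less_one_iff)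
      have "norm (Moebius_function 0 a w) \<le> norm (w - a) / (1 - \<alpha>)"
        unfolding norm_Moebius_function using norm_one_minus_cnj_mult_ge[of w a] w \<alpha>
        by (intro frac_le) (auto simp: \<alpha>_def)
      also have "\<dots> \<le> (4 * norm (k \<zeta>1 - k \<xi>) / (1 - \<alpha>\<^sup>2)) / (1 - \<alpha>)"
        using 1 a2 \<alpha> by (intro divide_right_mono) (auto simp: field_simps)
      finally show ?thesis by (simp add: w_def)
    qed
    moreover have "4 * norm (k \<zeta>1 - k \<xi>) / ((1 - \<alpha>\<^sup>2) * (1 - \<alpha>)) \<le> 4 * (64 * t / E\<^sup>2 + 2 * \<sigma>) / ((1 - \<alpha>\<^sup>2) * (1 - \<alpha>))"
      using kdiff \<alpha> by (intro divide_right_mono mult_left_mono mult_nonneg_nonneg) (auto simp: power_le_one)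
    ultimately show False using gap unfolding \<sigma>_def by linarith
  qed
qed

section \<open>Three approximate zeros of the second component\<close>

text \<open>The product of the three points is regrouped: \<open>x\<close> is the smaller point of
  one pair and \<open>y\<close> the full product of the other pair. This yields the power
  \<open>3/2\<close> of \<open>A\<close>.\<close>

lemma three_zero_bound:
  fixes g :: "complex \<Rightarrow> complex" and A :: real
  assumes g: "g holomorphic_on ball 0 1" "\<And>z. norm z < 1 \<Longrightarrow> norm (g z) \<le> M" "0 \<le> M"
    and pq: "norm p < 1" "g p = 0" "norm q < 1" "g q = 0" "p \<noteq> q"
    and s: "norm s < 1" and c: "0 < c" "c \<le> norm (Moebius_function 0 p s) * norm (Moebius_function 0 q s)"
    and A: "(norm x)\<^sup>2 \<le> A" "norm y \<le> A" "norm p * norm q * norm s = norm (x::complex) * norm (y::complex)"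
  shows "norm (g 0) \<le> M * (sqrt A * A) + 2 * norm (g s) / c"
proof -
  have "norm x \<le> sqrt A" using A(1) by (rule real_le_rsqrt)
  moreover have "0 \<le> A" using A(2) norm_ge_zero order_trans by blast
  ultimately have "norm x * norm y \<le> sqrt A * A" using A(2) by (intro mult_mono) auto
  then have "M * (norm p * norm q * norm s) \<le> M * (sqrt A * A)"
    unfolding A(3) using g(3) by (rule mult_left_mono)
  then show ?thesis using three_point_bound[OF g(1,2) pq s c] by linarith
qed

lemma min_square_le:
  assumes "norm (x * y) \<le> A"
  shows "(norm (x::complex))\<^sup>2 \<le> A \<or> (norm (y::complex))\<^sup>2 \<le> A"
proof (cases "norm x \<le> norm y")
  case True
  then have "norm x * norm x \<le> norm x * norm y" by (intro mult_left_mono) auto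
  then show ?thesis using assms by (simp add: norm_mult power2_eq_square)
next
  case False
  then have "norm y * norm y \<le> norm x * norm y" by (intro mult_right_mono) auto
  then show ?thesis using assms by (simp add: norm_mult power2_eq_square)
qed

text \<open>Two pairings of the same points interact: \<open>\<zeta>1\<close>,
  \<open>\<zeta>4\<close> and \<open>\<zeta>2\<close>, \<open>\<zeta>3\<close> are paired by
  \<open>f\<close>, whereas \<open>\<zeta>1\<close>, \<open>\<zeta>2\<close> and
  \<open>\<zeta>3\<close>, \<open>\<zeta>4\<close> are paired by \<open>g\<close>.\<close>

definition four_pole_disc :: "complex \<Rightarrow> complex \<Rightarrow> complex \<Rightarrow> (complex \<Rightarrow> complex) \<Rightarrow> (complex \<Rightarrow> complex) \<Rightarrow>
    complex \<Rightarrow> complex \<Rightarrow> complex \<Rightarrow> complex \<Rightarrow> bool" where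
  "four_pole_disc a \<gamma> \<epsilon> f g \<zeta>1 \<zeta>2 \<zeta>3 \<zeta>4 \<longleftrightarrow>
     f holomorphic_on ball 0 1 \<and> g holomorphic_on ball 0 1 \<and>
     (\<forall>z. norm z < 1 \<longrightarrow> norm (f z) < 1) \<and> (\<forall>z. norm z < 1 \<longrightarrow> norm (g z) < 1) \<and>
     f 0 = 0 \<and> g 0 = \<gamma> \<and>
     norm \<zeta>1 < 1 \<and> norm \<zeta>2 < 1 \<and> norm \<zeta>3 < 1 \<and> norm \<zeta>4 < 1 \<and>
     f \<zeta>1 = a \<and> g \<zeta>1 = 0 \<and> f \<zeta>2 = - a \<and> g \<zeta>2 = 0 \<and> f \<zeta>3 = - a \<and> g \<zeta>3 = \<epsilon> \<and> f \<zeta>4 = a \<and> g \<zeta>4 = \<epsilon>"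

text \<open>Each of the two factors is at least \<open>|a|\<close>, so a small total makes both
  nearly minimal, and then one pair is separated by at least \<open>t\<close>. Three approximate
  zeros of \<open>g\<close> or \<open>g - \<epsilon>\<close> now contradict the lower bound on
  \<open>|\<gamma>|\<close>. The four cases are: which pair is separated, and which point of the
  other pair is smaller.\<close>

lemma pole_product_lower_bound:
  fixes a \<gamma> :: complex
  assumes a: "0 < norm a" "norm a < 1" and \<gamma>: "norm a powr (3/2) < norm \<gamma>"
  obtains \<kappa> \<epsilon>0 :: real where "0 < \<kappa>" "0 < \<epsilon>0"
    "\<And>\<epsilon> f g \<zeta>1 \<zeta>2 \<zeta>3 \<zeta>4. \<lbrakk>\<epsilon> \<noteq> 0; norm \<epsilon> < \<epsilon>0; four_pole_disc a \<gamma> \<epsilon> f g \<zeta>1 \<zeta>2 \<zeta>3 \<zeta>4\<rbrakk>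
      \<Longrightarrow> (norm a)\<^sup>2 * (1 + \<kappa>) \<le> norm (\<zeta>1 * \<zeta>4) * norm (\<zeta>2 * \<zeta>3)"
proof -
  obtain t where t: "0 < t" and degenerate:
    "\<And>f \<zeta>1 \<zeta>2 \<zeta>3 \<zeta>4. \<lbrakk>f holomorphic_on ball 0 1; \<And>z. norm z < 1 \<Longrightarrow> norm (f z) < 1; f 0 = 0;
       norm \<zeta>1 < 1; norm \<zeta>2 < 1; norm \<zeta>3 < 1; norm \<zeta>4 < 1;
       f \<zeta>1 = a; f \<zeta>4 = a; f \<zeta>2 = - a; f \<zeta>3 = - a; \<zeta>1 \<noteq> \<zeta>4; \<zeta>2 \<noteq> \<zeta>3;
       norm (\<zeta>1 * \<zeta>4) \<le> norm a * (1 + t); norm (\<zeta>2 * \<zeta>3) \<le> norm a * (1 + t);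
       norm (Moebius_function 0 \<zeta>1 \<zeta>4) \<le> t; norm (Moebius_function 0 \<zeta>2 \<zeta>3) \<le> t\<rbrakk> \<Longrightarrow> False"
    using not_both_fibres_degenerate[OF a] by metis
  define A where "A \<kappa> = norm a * (1 + \<kappa>)" for \<kappa> :: real
  have "((\<lambda>\<kappa>. sqrt (A \<kappa>) * A \<kappa>) \<longlongrightarrow> sqrt (A 0) * A 0) (at_right 0)"
    unfolding A_def by (intro tendsto_intros)
  moreover have "sqrt (A 0) * A 0 < norm \<gamma>"
    using \<gamma> powr_add[of "norm a" "1/2" 1] a by (simp add: A_def powr_half_sqrt)
  ultimately have e1: "\<forall>\<^sub>F \<kappa> in at_right 0. sqrt (A \<kappa>) * A \<kappa> < norm \<gamma>"
    by (rule order_tendstoD(2))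
  \<comment> \<open>At \<open>\<kappa> = 0\<close> the left side is \<open>|a|\<close> to the power
    \<open>3/2\<close>, so the hypothesis on \<open>\<gamma>\<close> leaves room;
    \<open>\<kappa> < t\<close> makes \<open>degenerate\<close> applicable.\<close>
  from eventually_happens'[OF _ eventually_conj[OF e1 eventually_at_right_real[OF t]]]
  obtain \<kappa> where \<kappa>: "0 < \<kappa>" "\<kappa> < t" "sqrt (A \<kappa>) * A \<kappa> < norm \<gamma>" by auto
  \<comment> \<open>\<open>t\<close> is the separation within a pair and \<open>|a|\<close> the one
    between points with antipodal values of \<open>f\<close>.\<close>
  define c where "c = norm a * t"
  have c: "0 < c" using a t by (simp add: c_def)
  \<comment> \<open>The bound for the worse function \<open>g - \<epsilon>\<close> with
    \<open>e = |\<epsilon>|\<close>: its sup norm is at most \<open>1 + e\<close>, its value at the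
    approximate zero has modulus \<open>e\<close>, and the last \<open>e\<close> pays for passing
    from \<open>\<gamma> - \<epsilon>\<close> to \<open>\<gamma>\<close>.\<close>
  define R where "R e = (1 + e) * (sqrt (A \<kappa>) * A \<kappa>) + 2 * e / c + e" for e
  have "(R \<longlongrightarrow> R 0) (at_right 0)" unfolding R_def using c by (intro tendsto_intros) auto
  then have "\<forall>\<^sub>F e in at_right 0. R e < norm \<gamma>"
    by (rule order_tendstoD(2)) (use \<kappa> in \<open>simp add: R_def\<close>)
  then obtain \<epsilon>0 where \<epsilon>0: "0 < \<epsilon>0" "\<And>e. 0 < e \<Longrightarrow> e < \<epsilon>0 \<Longrightarrow> R e < norm \<gamma>"
    unfolding eventually_at_right_field by blast
  show ?thesis
  proof (rule that[OF \<kappa>(1) \<epsilon>0(1)], rule ccontr)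
    fix \<epsilon> f g \<zeta>1 \<zeta>2 \<zeta>3 \<zeta>4
    assume \<epsilon>: "\<epsilon> \<noteq> 0" "norm \<epsilon> < \<epsilon>0" and disc: "four_pole_disc a \<gamma> \<epsilon> f g \<zeta>1 \<zeta>2 \<zeta>3 \<zeta>4"
      and small: "\<not> (norm a)\<^sup>2 * (1 + \<kappa>) \<le> norm (\<zeta>1 * \<zeta>4) * norm (\<zeta>2 * \<zeta>3)"
    have f: "f holomorphic_on ball 0 1" and g: "g holomorphic_on ball 0 1"
      and f1: "\<And>z. norm z < 1 \<Longrightarrow> norm (f z) < 1" and g1: "\<And>z. norm z < 1 \<Longrightarrow> norm (g z) < 1"
      and f0: "f 0 = 0" and g0: "g 0 = \<gamma>"
      and \<zeta>: "norm \<zeta>1 < 1" "norm \<zeta>2 < 1" "norm \<zeta>3 < 1" "norm \<zeta>4 < 1"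
      and v: "f \<zeta>1 = a" "f \<zeta>2 = - a" "f \<zeta>3 = - a" "f \<zeta>4 = a" "g \<zeta>1 = 0" "g \<zeta>2 = 0" "g \<zeta>3 = \<epsilon>" "g \<zeta>4 = \<epsilon>"
      using disc by (auto simp: four_pole_disc_def)
    have ne: "\<zeta>1 \<noteq> \<zeta>4" "\<zeta>2 \<noteq> \<zeta>3" "\<zeta>1 \<noteq> \<zeta>2" "\<zeta>3 \<noteq> \<zeta>4" using v \<epsilon> a by force+
    have ge: "norm a \<le> norm (\<zeta>1 * \<zeta>4)" "norm a \<le> norm (\<zeta>2 * \<zeta>3)"
      using Blaschke_pair_factor[OF f f1 f0 \<zeta>(1,4) ne(1) v(1,4)]
        Blaschke_pair_factor[OF f f1 f0 \<zeta>(2,3) ne(2) v(2,3)] by (metis norm_minus_cancel)+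
    have le14: "norm (\<zeta>1 * \<zeta>4) \<le> A \<kappa>"
    proof -
      have "norm a * norm (\<zeta>1 * \<zeta>4) \<le> norm (\<zeta>1 * \<zeta>4) * norm (\<zeta>2 * \<zeta>3)"
        using mult_left_mono[OF ge(2), of "norm (\<zeta>1 * \<zeta>4)"] by (simp add: mult.commute)
      then have "norm a * norm (\<zeta>1 * \<zeta>4) \<le> norm a * A \<kappa>" using small by (simp add: A_def power2_eq_square mult.assoc)
      then show ?thesis using a by simp
    qed
    have le23: "norm (\<zeta>2 * \<zeta>3) \<le> A \<kappa>"
    proof -
      have "norm a * norm (\<zeta>2 * \<zeta>3) \<le> norm (\<zeta>1 * \<zeta>4) * norm (\<zeta>2 * \<zeta>3)"
        using mult_right_mono[OF ge(1), of "norm (\<zeta>2 * \<zeta>3)"] by simp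
      then have "norm a * norm (\<zeta>2 * \<zeta>3) \<le> norm a * A \<kappa>" using small by (simp add: A_def power2_eq_square mult.assoc)
      then show ?thesis using a by simp
    qed
    have A0: "0 \<le> A \<kappa>" "A \<kappa> \<le> norm a * (1 + t)" using a \<kappa> by (auto simp: A_def)
    have opposite: "norm a \<le> norm (Moebius_function 0 p s)" "norm a \<le> norm (Moebius_function 0 s p)"
      if "norm p < 1" "norm s < 1" "f p = a" "f s = - a" for p s
    proof -
      have "norm a \<le> norm (Moebius_function 0 (f p) (f s))"
        using norm_Moebius_antipodal_ge[of a] a that by simp
      also have "\<dots> \<le> norm (Moebius_function 0 p s)" by (rule Schwarz_Pick[OF f f1 that(1,2)])
      finally show "norm a \<le> norm (Moebius_function 0 p s)" "norm a \<le> norm (Moebius_function 0 s p)"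
        by (simp_all add: norm_Moebius_commute)
    qed
    have Rlt: "R (norm \<epsilon>) < norm \<gamma>" using \<epsilon> \<epsilon>0(2)[of "norm \<epsilon>"] by simp
    have low: False
      if pq: "norm p < 1" "g p = 0" "norm q < 1" "g q = 0" "p \<noteq> q" and s: "norm s < 1" "g s = \<epsilon>"
        and cc: "c \<le> norm (Moebius_function 0 p s) * norm (Moebius_function 0 q s)"
        and x: "(norm x)\<^sup>2 \<le> A \<kappa>" "norm y \<le> A \<kappa>" "norm p * norm q * norm s = norm x * norm y" for p q s x y :: complex
    proof -
      have "norm (g 0) \<le> 1 * (sqrt (A \<kappa>) * A \<kappa>) + 2 * norm (g s) / c"
        by (rule three_zero_bound[OF g _ _ pq s(1) c cc x]) (use g1 in \<open>auto intro: less_imp_le\<close>)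
      moreover have "0 \<le> norm \<epsilon> * (sqrt (A \<kappa>) * A \<kappa>)" using A0 by simp
      moreover have "0 \<le> norm \<epsilon>" by simp
      ultimately show False using Rlt unfolding g0 s(2) R_def distrib_right by linarith
    qed
    have high: False
      if pq: "norm p < 1" "g p = \<epsilon>" "norm q < 1" "g q = \<epsilon>" "p \<noteq> q" and s: "norm s < 1" "g s = 0"
        and cc: "c \<le> norm (Moebius_function 0 p s) * norm (Moebius_function 0 q s)"
        and x: "(norm x)\<^sup>2 \<le> A \<kappa>" "norm y \<le> A \<kappa>" "norm p * norm q * norm s = norm x * norm y" for p q s x y :: complex
    proof -
      have "norm (g 0 - \<epsilon>) \<le> (1 + norm \<epsilon>) * (sqrt (A \<kappa>) * A \<kappa>) + 2 * norm (g s - \<epsilon>) / c"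
      proof (rule three_zero_bound[where g = "\<lambda>z. g z - \<epsilon>", OF _ _ _ pq(1) _ pq(3) _ pq(5) s(1) c cc x])
        show "(\<lambda>z. g z - \<epsilon>) holomorphic_on ball 0 1" by (intro holomorphic_intros g)
        show "norm (g z - \<epsilon>) \<le> 1 + norm \<epsilon>" if "norm z < 1" for z
          using norm_triangle_ineq4[of "g z" \<epsilon>] g1[OF that] by simp
      qed (use pq in auto)
      then show False
        using Rlt norm_triangle_ineq2[of \<gamma> \<epsilon>] unfolding g0 s(2) R_def by simp
    qed
    consider "t \<le> norm (Moebius_function 0 \<zeta>1 \<zeta>4)" | "t \<le> norm (Moebius_function 0 \<zeta>2 \<zeta>3)"
      using degenerate[OF f f1 f0 \<zeta> v(1,4,2,3) ne(1,2)] le14 le23 A0(2) by (meson le_cases order_trans)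
    then show False
    proof cases
      \<comment> \<open>The exact zeros are the smaller of \<open>\<zeta>2\<close>,
        \<open>\<zeta>3\<close> and the point of the separated pair at the same height; the other
        point of that pair is the approximate zero \<open>s\<close>. The height decides between
        \<open>low\<close> and \<open>high\<close>.\<close>
      case 1
      have 14: "c \<le> norm (Moebius_function 0 \<zeta>1 \<zeta>4) * d" "c \<le> d * norm (Moebius_function 0 \<zeta>1 \<zeta>4)"
        if "norm a \<le> d" for d
        using mult_mono[OF 1 that] a t by (simp_all add: c_def mult.commute)
      from min_square_le[OF le23] show False
      proof
        assume x: "(norm \<zeta>2)\<^sup>2 \<le> A \<kappa>"
        show False
          by (rule low[OF \<zeta>(1) v(5) \<zeta>(2) v(6) ne(3) \<zeta>(4) v(8) 14(1)[OF opposite(2)[OF \<zeta>(4,2) v(4,2)]] x le14])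
            (simp add: norm_mult)
      next
        assume x: "(norm \<zeta>3)\<^sup>2 \<le> A \<kappa>"
        show False
          by (rule high[OF \<zeta>(3) v(7) \<zeta>(4) v(8) ne(4) \<zeta>(1) v(5) _ x le14])
            (use 14(2)[OF opposite(2)[OF \<zeta>(1,3) v(1,3)]] in \<open>simp_all add: norm_mult norm_Moebius_commute[of \<zeta>4 \<zeta>1]\<close>)
      qed
    next
      case 2
      have 23: "c \<le> norm (Moebius_function 0 \<zeta>2 \<zeta>3) * d" "c \<le> d * norm (Moebius_function 0 \<zeta>2 \<zeta>3)"
        if "norm a \<le> d" for d
        using mult_mono[OF 2 that] a t by (simp_all add: c_def mult.commute)
      from min_square_le[OF le14] show False
      proof
        assume x: "(norm \<zeta>1)\<^sup>2 \<le> A \<kappa>"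
        show False
          by (rule low[OF \<zeta>(1) v(5) \<zeta>(2) v(6) ne(3) \<zeta>(3) v(7) 23(2)[OF opposite(1)[OF \<zeta>(1,3) v(1,3)]] x le23])
            (simp add: norm_mult)
      next
        assume x: "(norm \<zeta>4)\<^sup>2 \<le> A \<kappa>"
        show False
          by (rule high[OF \<zeta>(3) v(7) \<zeta>(4) v(8) ne(4) \<zeta>(2) v(6) _ x le23])
            (use 23(1)[OF opposite(1)[OF \<zeta>(4,2) v(4,2)]] in \<open>simp_all add: norm_mult norm_Moebius_commute[of \<zeta>3 \<zeta>2]\<close>)
      qed
    qed
  qed
qed

section \<open>Passage to logarithms and conclusion\<close>

lemma coman_lempert_ge:
  assumes low: "\<And>f g \<zeta>1 \<zeta>2 \<zeta>3 \<zeta>4. four_pole_disc a \<gamma> \<epsilon> f g \<zeta>1 \<zeta>2 \<zeta>3 \<zeta>4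
      \<Longrightarrow> m \<le> norm (\<zeta>1 * \<zeta>4) * norm (\<zeta>2 * \<zeta>3)"
    and a: "a \<noteq> 0" and m: "0 < m"
  shows "ereal (ln m) \<le> coman_lempert [(a,0), (-a,0), (-a,\<epsilon>), (a,\<epsilon>)] (0, \<gamma>)"
  unfolding coman_lempert_def
proof (rule Inf_greatest, clarify)
  fix \<phi> :: "complex \<Rightarrow> c2" and \<zeta> :: "nat \<Rightarrow> complex"
  assume hol: "(fst \<circ> \<phi>) holomorphic_on unit_disc" "(snd \<circ> \<phi>) holomorphic_on unit_disc"
    and im: "\<phi> ` unit_disc \<subseteq> bidisc" and \<phi>0: "\<phi> 0 = (0, \<gamma>)"
    and hit: "\<forall>j<length [(a,0), (-a,0), (-a,\<epsilon>), (a,\<epsilon>)]. \<zeta> j \<in> unit_disc \<and> \<phi> (\<zeta> j) = [(a,0), (-a,0), (-a,\<epsilon>), (a,\<epsilon>)] ! j"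
  have bd: "norm (fst (\<phi> z)) < 1 \<and> norm (snd (\<phi> z)) < 1" if "norm z < 1" for z
  proof -
    have "\<phi> z \<in> bidisc" using im that by (auto simp: unit_disc_def)
    then show ?thesis by (auto simp: bidisc_def unit_disc_def)
  qed
  have \<zeta>: "norm (\<zeta> 0) < 1" "norm (\<zeta> 1) < 1" "norm (\<zeta> 2) < 1" "norm (\<zeta> 3) < 1"
    "\<phi> (\<zeta> 0) = (a, 0)" "\<phi> (\<zeta> 1) = (- a, 0)" "\<phi> (\<zeta> 2) = (- a, \<epsilon>)" "\<phi> (\<zeta> 3) = (a, \<epsilon>)"
    using hit[rule_format, of 0] hit[rule_format, of 1] hit[rule_format, of 2] hit[rule_format, of 3]
    by (auto simp: unit_disc_def numeral_3_eq_3)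
  have le: "m \<le> norm (\<zeta> 0 * \<zeta> 3) * norm (\<zeta> 1 * \<zeta> 2)"
    by (rule low[of "fst \<circ> \<phi>" "snd \<circ> \<phi>"])
      (use hol bd \<phi>0 \<zeta> in \<open>simp add: unit_disc_def four_pole_disc_def\<close>)
  \<comment> \<open>The disc starts over 0 while the poles lie over \<open>a\<close> and
    \<open>- a\<close>; hence no summand takes the value of \<open>eln\<close> at 0.\<close>
  have nz: "\<zeta> 0 \<noteq> 0" "\<zeta> 1 \<noteq> 0" "\<zeta> 2 \<noteq> 0" "\<zeta> 3 \<noteq> 0"
    using \<zeta> \<phi>0 a by auto
  have "ln m \<le> ln (norm (\<zeta> 0 * \<zeta> 3) * norm (\<zeta> 1 * \<zeta> 2))"
    using le m nz by simp
  also have "\<dots> = ln (norm (\<zeta> 0)) + ln (norm (\<zeta> 1)) + ln (norm (\<zeta> 2)) + ln (norm (\<zeta> 3))"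
    using nz by (simp add: norm_mult ln_mult)
  finally have "ereal (ln m) \<le> ereal (ln (norm (\<zeta> 0)) + ln (norm (\<zeta> 1)) + ln (norm (\<zeta> 2)) + ln (norm (\<zeta> 3)))"
    by simp
  also have "\<dots> = (\<Sum>j<length [(a,0), (-a,0), (-a,\<epsilon>), (a,\<epsilon>)]. eln (norm (\<zeta> j)))"
    using nz by (simp add: eln_def numeral_2_eq_2 numeral_3_eq_3)
  finally show "ereal (ln m) \<le> (\<Sum>j<length [(a,0), (-a,0), (-a,\<epsilon>), (a,\<epsilon>)]. eln (norm (\<zeta> j)))" .
qed

theorem mainTheorem17:
  fixes a b \<gamma> :: complex and z :: c2
  assumes "a \<in> unit_disc" and "b = - a" and "z = (0, \<gamma>)"
    and "norm a powr (3/2) < norm \<gamma>" and "norm \<gamma> < norm a"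
  shows "Liminf (at 0) (\<lambda>\<epsilon>. coman_lempert [(a,0), (b,0), (b,\<epsilon>), (a,\<epsilon>)] z) > G_aVbV a b z
    \<and> eventually (\<lambda>\<epsilon>. green [(a,0), (b,0), (b,\<epsilon>), (a,\<epsilon>)] z
                         < coman_lempert [(a,0), (b,0), (b,\<epsilon>), (a,\<epsilon>)] z) (at 0)
    \<and> (\<exists>\<epsilon>. \<epsilon> \<noteq> 0 \<and> green [(a,0), (b,0), (b,\<epsilon>), (a,\<epsilon>)] z
                         < coman_lempert [(a,0), (b,0), (b,\<epsilon>), (a,\<epsilon>)] z)"
proof -
  have a1: "norm a < 1" using assms(1) by (simp add: unit_disc_def)
  have a0: "0 < norm a" using assms(5) norm_ge_zero le_less_trans by blast
  define L where "L \<epsilon> = coman_lempert [(a,0), (b,0), (b,\<epsilon>), (a,\<epsilon>)] z" for \<epsilon>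
  obtain \<kappa> \<epsilon>0 :: real where \<kappa>: "0 < \<kappa>" and \<epsilon>0: "0 < \<epsilon>0" and
    low: "\<And>\<epsilon> f g \<zeta>1 \<zeta>2 \<zeta>3 \<zeta>4. \<lbrakk>\<epsilon> \<noteq> 0; norm \<epsilon> < \<epsilon>0; four_pole_disc a \<gamma> \<epsilon> f g \<zeta>1 \<zeta>2 \<zeta>3 \<zeta>4\<rbrakk>
      \<Longrightarrow> (norm a)\<^sup>2 * (1 + \<kappa>) \<le> norm (\<zeta>1 * \<zeta>4) * norm (\<zeta>2 * \<zeta>3)"
    using pole_product_lower_bound[OF a0 a1 assms(4)] by metis
  \<comment> \<open>\<open>l\<close> is \<open>2 ln |a| + ln (1 + \<kappa>)\<close>, independent of
    \<open>\<epsilon>\<close>, while both Green functions stay below \<open>2 ln |a|\<close> or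
    equal it.\<close>
  define l where "l = ln ((norm a)\<^sup>2 * (1 + \<kappa>))"
  have "ln ((norm a)\<^sup>2) < l"
    unfolding l_def using a0 \<kappa> by (subst ln_less_cancel_iff) (auto intro: mult_pos_pos)
  then have l: "2 * ln (norm a) < l" using a0 by (simp add: ln_realpow)
  have Lge: "ereal l \<le> L \<epsilon>" if "\<epsilon> \<noteq> 0" "norm \<epsilon> < \<epsilon>0" for \<epsilon>
    unfolding L_def l_def assms(2,3)
    by (rule coman_lempert_ge) (use low[OF that] a0 \<kappa> in auto)
  have "\<forall>\<^sub>F \<epsilon> in at (0::complex). \<epsilon> \<noteq> 0 \<and> norm \<epsilon> < \<epsilon>0"
    unfolding eventually_at using \<epsilon>0 by (auto simp: dist_norm)
  then have evL: "\<forall>\<^sub>F \<epsilon> in at 0. ereal l \<le> L \<epsilon>"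
    by (rule eventually_mono) (auto intro: Lge)
  have "ereal l \<le> Liminf (at 0) L" by (rule Liminf_bounded[OF evL])
  moreover have "G_aVbV a b z \<le> ereal (2 * ln (norm a))"
    unfolding assms(2,3) by (rule G_aVbV_le[OF a1 assms(5)])
  ultimately have 1: "G_aVbV a b z < Liminf (at 0) L"
    using l by (meson le_less_trans less_le_trans less_ereal.simps(1))
  \<comment> \<open>The limit is \<open>|\<gamma>|^2 / |a|^2 < 1\<close>, so the condition of
    \<open>green_le\<close> on the coefficient of the curve holds for small
    \<open>\<epsilon>\<close>.\<close>
  have "((\<lambda>\<epsilon>. norm (\<gamma> * (\<gamma> - \<epsilon>)) / (norm a)\<^sup>2 + norm \<epsilon>) \<longlongrightarrow> norm (\<gamma> * (\<gamma> - 0)) / (norm a)\<^sup>2 + norm (0::complex)) (at 0)"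
    using a0 by (intro tendsto_intros) auto
  moreover have "(norm \<gamma>)\<^sup>2 < (norm a)\<^sup>2" using assms(5) by (intro power_strict_mono) auto
  then have "norm (\<gamma> * (\<gamma> - 0)) / (norm a)\<^sup>2 + norm (0::complex) < 1"
    using a0 by (simp add: norm_mult power2_eq_square)
  ultimately have "\<forall>\<^sub>F \<epsilon> in at 0. norm (\<gamma> * (\<gamma> - \<epsilon>)) / (norm a)\<^sup>2 + norm \<epsilon> < 1"
    by (rule order_tendstoD(2))
  moreover have ne: "\<forall>\<^sub>F \<epsilon> in at (0::complex). \<epsilon> \<noteq> 0" by (rule eventually_neq_at_within)
  ultimately have 2: "\<forall>\<^sub>F \<epsilon> in at 0. green [(a,0), (b,0), (b,\<epsilon>), (a,\<epsilon>)] z < L \<epsilon>"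
    using evL
  proof eventually_elim
    case (elim \<epsilon>)
    have "green [(a,0), (b,0), (b,\<epsilon>), (a,\<epsilon>)] z \<le> ereal (2 * ln (norm a))"
      unfolding assms(2,3) by (rule green_le[OF a1 a0 _ elim(2,1)]) (use assms(5) a1 in simp)
    also have "\<dots> < ereal l" using l by simp
    finally show ?case using elim(3) by (rule less_le_trans)
  qed
  from eventually_happens'[OF _ eventually_conj[OF ne 2]]
  have 3: "\<exists>\<epsilon>. \<epsilon> \<noteq> 0 \<and> green [(a,0), (b,0), (b,\<epsilon>), (a,\<epsilon>)] z < L \<epsilon>" by auto
  show ?thesis using 1 2 3 unfolding L_def by blast
qed

end
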